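(* Let $M$ be a connected smooth manifold of dimension $n>2$, and let $g$ be a light-line-complete pseudo-Riemannian Einstein metric of indefinite signature on $M$ (i.e., for no constant $c$ is the metric $c\cdot g$ Riemannian). Let $\psi: M\to\mathbb{R}$ be a smooth nowhere vanishing function such that the metric $\psi^{-2} g$ is also Einstein. Then $\psi$ is constant.
   Context: Manifolds, metrics and functions are smooth. A pseudo-Riemannian metric $g$ on an $n$-dimensional manifold is called Einstein if its Ricci tensor is proportional to the metric, i.e. $\mathrm{Ric}_g=\frac{R}{n}\,g$, where $R$ is the scalar curvature of $g$ (for connected $M$ with $n>2$, $R$ is then automatically constant). A light-line geodesic of $g$ is a (nonconstant, affinely parametrized) geodesic $\gamma$ of the Levi-Civita connection of $g$ with $g(\dot\gamma(t),\dot\gamma(t))=0$ for all $t$. The metric $g$ is light-line-complete if every light-line geodesic of $g$ can be extended, with its affine parameter, to a geodesic defined on all of $\mathbb{R}$. *)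

theory Defs
  imports "HOL-Analysis.Analysis"
begin

section \<open>Smooth maps between Euclidean spaces\<close>

text \<open>These notions are used for open \<open>S\<close> only.  In finite dimensions, differentiability together
  with \<open>C\<^sup>k\<close>-regularity of all directional derivatives is \<open>C\<^sup>k\<^sup>+\<^sup>1\<close>-regularity.\<close>

primrec Ck_on ::
  "nat \<Rightarrow> 'a::euclidean_space set \<Rightarrow> ('a \<Rightarrow> 'b::real_normed_vector) \<Rightarrow> bool" where
  "Ck_on 0 S f \<longleftrightarrow> continuous_on S f"
| "Ck_on (Suc k) S f \<longleftrightarrow>
     (\<forall>x\<in>S. f differentiable (at x)) \<and>
     (\<forall>v. Ck_on k S (\<lambda>x. frechet_derivative f (at x) v))"

definition smooth_on :: "'a::euclidean_space set \<Rightarrow> ('a \<Rightarrow> 'b::real_normed_vector) \<Rightarrow> bool" where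
  "smooth_on S f \<longleftrightarrow> (\<forall>k. Ck_on k S f)"

definition pderiv_at :: "'n::finite \<Rightarrow> (real ^ 'n \<Rightarrow> real) \<Rightarrow> real ^ 'n \<Rightarrow> real" where
  "pderiv_at i f x = frechet_derivative f (at x) (axis i 1)"


section \<open>Smooth manifolds\<close>

text \<open>A chart is a pair of its domain and its coordinate map; the values of the coordinate map
  outside the domain are irrelevant.  The manifold has dimension \<open>CARD('n)\<close>.  The atlas is any
  smooth atlas, not necessarily a maximal one.\<close>

type_synonym ('a, 'n) chart = "'a set \<times> ('a \<Rightarrow> real ^ 'n)"

definition chart_inv :: "('a, 'n::finite) chart \<Rightarrow> real ^ 'n \<Rightarrow> 'a" where
  "chart_inv c = inv_into (fst c) (snd c)"

definition is_chart :: "'a topology \<Rightarrow> ('a, 'n::finite) chart \<Rightarrow> bool" where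
  "is_chart X c \<longleftrightarrow>
     openin X (fst c) \<and> open (snd c ` fst c) \<and>
     homeomorphic_map (subtopology X (fst c)) (top_of_set (snd c ` fst c)) (snd c)"

definition smooth_manifold :: "'a topology \<Rightarrow> ('a, 'n::finite) chart set \<Rightarrow> bool" where
  "smooth_manifold X A \<longleftrightarrow>
     Hausdorff_space X \<and> second_countable X \<and>
     (\<forall>c\<in>A. is_chart X c) \<and>
     (\<Union>c\<in>A. fst c) = topspace X \<and>
     (\<forall>c\<in>A. \<forall>d\<in>A. smooth_on (snd c ` (fst c \<inter> fst d)) (snd d \<circ> chart_inv c))"

definition smooth_function :: "('a, 'n::finite) chart set \<Rightarrow> ('a \<Rightarrow> real) \<Rightarrow> bool" where
  "smooth_function A f \<longleftrightarrow> (\<forall>c\<in>A. smooth_on (snd c ` fst c) (f \<circ> chart_inv c))"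


section \<open>Tangent vectors\<close>

text \<open>A tangent vector at \<open>p\<close> is the family of its coordinate tuples in the charts around \<open>p\<close>,
  related by the differentials of the transition maps; it is \<open>0\<close> at all other indices, so that
  equal tangent vectors are equal as functions.\<close>

type_synonym ('a, 'n) tangent = "('a, 'n) chart \<Rightarrow> real ^ 'n"

definition transition_deriv ::
  "('a, 'n::finite) chart \<Rightarrow> ('a, 'n) chart \<Rightarrow> 'a \<Rightarrow> real ^ 'n \<Rightarrow> real ^ 'n" where
  "transition_deriv c d p = frechet_derivative (snd d \<circ> chart_inv c) (at (snd c p))"

definition tangent_space :: "('a, 'n::finite) chart set \<Rightarrow> 'a \<Rightarrow> ('a, 'n) tangent set" where
  "tangent_space A p = {v.
     (\<forall>c. \<not> (c \<in> A \<and> p \<in> fst c) \<longrightarrow> v c = 0) \<and>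
     (\<forall>c\<in>A. \<forall>d\<in>A. p \<in> fst c \<inter> fst d \<longrightarrow> v d = transition_deriv c d p (v c))}"

definition coord_vector ::
  "('a, 'n::finite) chart set \<Rightarrow> ('a, 'n) chart \<Rightarrow> 'n \<Rightarrow> 'a \<Rightarrow> ('a, 'n) tangent" where
  "coord_vector A c i p =
     (\<lambda>d. if d \<in> A \<and> p \<in> fst d then transition_deriv c d p (axis i 1) else 0)"

definition velocity ::
  "('a, 'n::finite) chart set \<Rightarrow> (real \<Rightarrow> 'a) \<Rightarrow> real \<Rightarrow> ('a, 'n) tangent" where
  "velocity A \<gamma> t =
     (\<lambda>d. if d \<in> A \<and> \<gamma> t \<in> fst d then vector_derivative (snd d \<circ> \<gamma>) (at t) else 0)"


section \<open>Pseudo-Riemannian metrics\<close>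

type_synonym ('a, 'n) metric = "'a \<Rightarrow> ('a, 'n) tangent \<Rightarrow> ('a, 'n) tangent \<Rightarrow> real"

definition metric_matrix ::
  "('a, 'n::finite) chart set \<Rightarrow> ('a, 'n) metric \<Rightarrow> ('a, 'n) chart \<Rightarrow> real ^ 'n \<Rightarrow> real ^ 'n ^ 'n"
  where
  "metric_matrix A g c x =
     (let p = chart_inv c x in \<chi> i j. g p (coord_vector A c i p) (coord_vector A c j p))"

definition pseudo_riemannian_metric ::
  "'a topology \<Rightarrow> ('a, 'n::finite) chart set \<Rightarrow> ('a, 'n) metric \<Rightarrow> bool" where
  "pseudo_riemannian_metric X A g \<longleftrightarrow>
     (\<forall>p\<in>topspace X.
        (\<forall>u\<in>tangent_space A p. \<forall>v\<in>tangent_space A p. \<forall>w\<in>tangent_space A p. \<forall>a b.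
           g p (\<lambda>c. a *\<^sub>R u c + b *\<^sub>R v c) w = a * g p u w + b * g p v w) \<and>
        (\<forall>u\<in>tangent_space A p. \<forall>v\<in>tangent_space A p. g p u v = g p v u) \<and>
        (\<forall>u\<in>tangent_space A p. (\<forall>v\<in>tangent_space A p. g p u v = 0) \<longrightarrow> u = (\<lambda>c. 0))) \<and>
     (\<forall>c\<in>A. \<forall>i j. smooth_on (snd c ` fst c) (\<lambda>x. metric_matrix A g c x $ i $ j))"

definition riemannian_metric ::
  "'a topology \<Rightarrow> ('a, 'n::finite) chart set \<Rightarrow> ('a, 'n) metric \<Rightarrow> bool" where
  "riemannian_metric X A g \<longleftrightarrow>
     pseudo_riemannian_metric X A g \<and>
     (\<forall>p\<in>topspace X. \<forall>v\<in>tangent_space A p. v \<noteq> (\<lambda>c. 0) \<longrightarrow> g p v v > 0)"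

definition indefinite_metric ::
  "'a topology \<Rightarrow> ('a, 'n::finite) chart set \<Rightarrow> ('a, 'n) metric \<Rightarrow> bool" where
  "indefinite_metric X A g \<longleftrightarrow>
     pseudo_riemannian_metric X A g \<and>
     \<not> (\<exists>c::real. riemannian_metric X A (\<lambda>p u v. c * g p u v))"


section \<open>Levi-Civita connection and curvature in coordinates\<close>

text \<open>Here \<open>G\<close> is the matrix of a metric as a function of the coordinates.  \<open>christoffel G k i j\<close>
  is $\Gamma^k_{ij}$; \<open>riemann G l k i j\<close> is the \<open>l\<close>-th component of
  $R(\partial_i, \partial_j)\partial_k$, where
  $R(X,Y) = [\nabla_X, \nabla_Y] - \nabla_{[X,Y]}$.\<close>

definition christoffel ::
  "(real ^ 'n \<Rightarrow> real ^ 'n ^ 'n) \<Rightarrow> 'n::finite \<Rightarrow> 'n \<Rightarrow> 'n \<Rightarrow> real ^ 'n \<Rightarrow> real" where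
  "christoffel G k i j x =
     1/2 * (\<Sum>l\<in>UNIV. matrix_inv (G x) $ k $ l *
       (pderiv_at i (\<lambda>y. G y $ j $ l) x
        + pderiv_at j (\<lambda>y. G y $ i $ l) x
        - pderiv_at l (\<lambda>y. G y $ i $ j) x))"

definition riemann ::
  "(real ^ 'n \<Rightarrow> real ^ 'n ^ 'n) \<Rightarrow> 'n::finite \<Rightarrow> 'n \<Rightarrow> 'n \<Rightarrow> 'n \<Rightarrow> real ^ 'n \<Rightarrow> real" where
  "riemann G l k i j x =
     pderiv_at i (christoffel G l j k) x - pderiv_at j (christoffel G l i k) x
     + (\<Sum>m\<in>UNIV. christoffel G l i m x * christoffel G m j k x
                 - christoffel G l j m x * christoffel G m i k x)"

definition ricci :: "(real ^ 'n \<Rightarrow> real ^ 'n ^ 'n) \<Rightarrow> real ^ 'n \<Rightarrow> real ^ 'n::finite ^ 'n" where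
  "ricci G x = (\<chi> j k. \<Sum>i\<in>UNIV. riemann G i k i j x)"

definition scalar_curvature ::
  "(real ^ 'n \<Rightarrow> real ^ 'n ^ 'n) \<Rightarrow> real ^ 'n::finite \<Rightarrow> real" where
  "scalar_curvature G x = (\<Sum>i\<in>UNIV. \<Sum>j\<in>UNIV. matrix_inv (G x) $ i $ j * ricci G x $ i $ j)"

definition einstein_metric ::
  "'a topology \<Rightarrow> ('a, 'n::finite) chart set \<Rightarrow> ('a, 'n) metric \<Rightarrow> bool" where
  "einstein_metric X A g \<longleftrightarrow>
     pseudo_riemannian_metric X A g \<and>
     (\<forall>c\<in>A. \<forall>x\<in>snd c ` fst c.
        ricci (metric_matrix A g c) x =
          (scalar_curvature (metric_matrix A g c) x / real CARD('n)) *\<^sub>R metric_matrix A g c x)"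


section \<open>Geodesics\<close>

text \<open>By the transformation law of the Christoffel symbols it does not matter in which chart the
  geodesic equation is imposed near a given parameter value.  Its solutions are automatically
  smooth.  Only open intervals are considered as domains: a geodesic on any nondegenerate interval
  extends to an open one.\<close>

definition geodesic ::
  "('a, 'n::finite) chart set \<Rightarrow> ('a, 'n) metric \<Rightarrow> real set \<Rightarrow> (real \<Rightarrow> 'a) \<Rightarrow> bool" where
  "geodesic A g I \<gamma> \<longleftrightarrow>
     open I \<and> is_interval I \<and>
     (\<forall>t\<in>I. \<exists>c\<in>A. \<exists>J x'. open J \<and> t \<in> J \<and> J \<subseteq> I \<and> \<gamma> ` J \<subseteq> fst c \<and>
        (\<forall>s\<in>J.
           ((snd c \<circ> \<gamma>) has_vector_derivative x' s) (at s) \<and>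
           (x' has_vector_derivative
              (\<chi> k. - (\<Sum>i\<in>UNIV. \<Sum>j\<in>UNIV.
                 christoffel (metric_matrix A g c) k i j (snd c (\<gamma> s)) * x' s $ i * x' s $ j)))
             (at s)))"

definition light_line_geodesic ::
  "('a, 'n::finite) chart set \<Rightarrow> ('a, 'n) metric \<Rightarrow> real set \<Rightarrow> (real \<Rightarrow> 'a) \<Rightarrow> bool" where
  "light_line_geodesic A g I \<gamma> \<longleftrightarrow>
     geodesic A g I \<gamma> \<and> \<not> \<gamma> constant_on I \<and>
     (\<forall>t\<in>I. g (\<gamma> t) (velocity A \<gamma> t) (velocity A \<gamma> t) = 0)"

definition light_line_complete ::
  "('a, 'n::finite) chart set \<Rightarrow> ('a, 'n) metric \<Rightarrow> bool" where
  "light_line_complete A g \<longleftrightarrow>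
     (\<forall>I \<gamma>. light_line_geodesic A g I \<gamma> \<longrightarrow>
        (\<exists>\<gamma>'. geodesic A g UNIV \<gamma>' \<and> (\<forall>t\<in>I. \<gamma>' t = \<gamma> t)))"

end

theory Submission
  imports Defs
begin

text \<open>
Write \<open>g' = \<psi>\<^sup>-\<^sup>2 g\<close>, and let \<open>v\<close> be a null vector of \<open>g\<close>.  The classical formula for
the Ricci tensor under a conformal change contains a multiple of \<open>g\<close>, which \<open>v\<close> does not see, so that
\<open>Ric'(v, v) - Ric(v, v) = (n - 2) / \<psi> * Hess \<psi> (v, v)\<close> (\<open>ricci_null_change\<close>).  Both Ricci tensors are
multiples of \<open>g\<close> because both metrics are Einstein.  The left-hand side therefore vanishes, and since
\<open>n > 2\<close> the Hessian of \<open>\<psi>\<close> is zero on null vectors (\<open>hessian_null\<close>).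

The second derivative of \<open>\<psi>\<close> along a geodesic is the Hessian evaluated on the velocity, and the length of
the velocity is conserved (\<open>geodesic_energy\<close>).  So \<open>\<psi>\<close> is an affine function of the parameter along every
light-line geodesic.  By completeness this holds on the whole real line, where an affine function without
zeros is constant.  Through each null vector \<open>v\<close> there is a light-line geodesic
(\<open>null_geodesic_exists\<close>); hence \<open>d\<psi>(v) = 0\<close> (\<open>null_derivative_zero\<close>).

It remains to see that null vectors span the tangent space.  By connectedness an indefinite metric is
indefinite at every single point (\<open>indefinite_everywhere\<close>), and a linear form that vanishes on the null
vectors of an indefinite form is zero (\<open>null_directions_span\<close>).  Thus \<open>d\<psi> = 0\<close>, and \<open>\<psi>\<close> is constant on
the connected space.

The geodesics are obtained from the contraction principle (\<open>picard_global\<close>).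
\<close>

section \<open>Calculus of smooth functions\<close>

lemma Ck_on_cong:
  assumes "open S" "\<And>x. x \<in> S \<Longrightarrow> f x = g x" "Ck_on k S f"
  shows "Ck_on k S g"
  using assms(2,3)
proof (induction k arbitrary: f g)
  case 0
  then show ?case by (metis Ck_on.simps(1) continuous_on_cong)
next
  case (Suc k)
  have df: "f differentiable (at x)" if "x \<in> S" for x
    using Suc.prems(2) that by simp
  have dg: "g differentiable (at x)" if "x \<in> S" for x
    using df[OF that] has_derivative_transform_within_open[OF _ assms(1) that]
      Suc.prems(1) unfolding differentiable_def by blast
  have eq: "frechet_derivative f (at x) v = frechet_derivative g (at x) v" if "x \<in> S" for x v
    using frechet_derivative_transform_within_open[OF df[OF that] assms(1) that] Suc.prems(1)
    by metis
  show ?case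
    using dg Suc.IH[OF eq] Suc.prems(2) by simp
qed

lemma Ck_on_Suc_imp: "Ck_on (Suc k) S f \<Longrightarrow> Ck_on k S f"
proof (induction k arbitrary: f)
  case 0
  then show ?case
    by (simp add: continuous_at_imp_continuous_on differentiable_imp_continuous_within)
next
  case (Suc k)
  then show ?case by (metis Ck_on.simps(2))
qed

lemma Ck_on_const: "Ck_on k S (\<lambda>x. c)"
  by (induction k arbitrary: c) auto

lemma Ck_on_add:
  assumes "open S" "Ck_on k S f" "Ck_on k S g"
  shows "Ck_on k S (\<lambda>x. f x + g x)"
  using assms(2,3)
proof (induction k arbitrary: f g)
  case 0
  then show ?case by (simp add: continuous_on_add)
next
  case (Suc k)
  have d: "f differentiable (at x)" "g differentiable (at x)" if "x \<in> S" for x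
    using Suc.prems that by auto
  have "Ck_on k S (\<lambda>x. frechet_derivative (\<lambda>x. f x + g x) (at x) v)" for v
  proof (rule Ck_on_cong[OF assms(1)])
    show "frechet_derivative f (at x) v + frechet_derivative g (at x) v =
        frechet_derivative (\<lambda>x. f x + g x) (at x) v" if "x \<in> S" for x
      using frechet_derivative_at[OF has_derivative_add[OF d(1)[OF that, unfolded frechet_derivative_works]
          d(2)[OF that, unfolded frechet_derivative_works]]] by metis
    show "Ck_on k S (\<lambda>x. frechet_derivative f (at x) v + frechet_derivative g (at x) v)"
      using Suc by simp
  qed
  then show ?case using d by simp
qed

lemma Ck_on_mult:
  fixes f g :: "'a::euclidean_space \<Rightarrow> real"
  assumes "open S" "Ck_on k S f" "Ck_on k S g"
  shows "Ck_on k S (\<lambda>x. f x * g x)"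
  using assms(2,3)
proof (induction k arbitrary: f g)
  case 0
  then show ?case by (simp add: continuous_on_mult)
next
  case (Suc k)
  have d: "f differentiable (at x)" "g differentiable (at x)" if "x \<in> S" for x
    using Suc.prems that by auto
  have "Ck_on k S (\<lambda>x. frechet_derivative (\<lambda>x. f x * g x) (at x) v)" for v
  proof (rule Ck_on_cong[OF assms(1)])
    show "f x * frechet_derivative g (at x) v + frechet_derivative f (at x) v * g x =
        frechet_derivative (\<lambda>x. f x * g x) (at x) v" if "x \<in> S" for x
      using frechet_derivative_at[OF has_derivative_mult[OF d(1)[OF that, unfolded frechet_derivative_works]
          d(2)[OF that, unfolded frechet_derivative_works]]] by metis
    show "Ck_on k S (\<lambda>x. f x * frechet_derivative g (at x) v + frechet_derivative f (at x) v * g x)"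
      using Suc.prems[THEN Ck_on_Suc_imp] Suc.prems
      by (intro Ck_on_add[OF assms(1)] Suc.IH) auto
  qed
  then show ?case using d by simp
qed

lemma Ck_on_inverse:
  fixes f :: "'a::euclidean_space \<Rightarrow> real"
  assumes "open S" "Ck_on k S f" "\<And>x. x \<in> S \<Longrightarrow> f x \<noteq> 0"
  shows "Ck_on k S (\<lambda>x. inverse (f x))"
  using assms(2)
proof (induction k)
  case 0
  then show ?case using assms(3) by (simp add: continuous_on_inverse)
next
  case (Suc k)
  have d: "f differentiable (at x)" if "x \<in> S" for x
    using Suc.prems that by auto
  have "Ck_on k S (\<lambda>x. frechet_derivative (\<lambda>x. inverse (f x)) (at x) v)" for v
  proof (rule Ck_on_cong[OF assms(1)])
    show "(-1) * (inverse (f x) * (frechet_derivative f (at x) v * inverse (f x))) =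
        frechet_derivative (\<lambda>x. inverse (f x)) (at x) v" if "x \<in> S" for x
      using frechet_derivative_at[OF Deriv.has_derivative_inverse[OF assms(3)[OF that]
          d(1)[OF that, unfolded frechet_derivative_works]]] by (simp add: fun_eq_iff mult.assoc)
    show "Ck_on k S (\<lambda>x. (-1) * (inverse (f x) * (frechet_derivative f (at x) v * inverse (f x))))"
      using Suc Ck_on_Suc_imp by (intro Ck_on_mult[OF assms(1)] Ck_on_const) auto
  qed
  then show ?case using d assms(3) by simp
qed

lemma smooth_on_cong:
  "open S \<Longrightarrow> smooth_on S f \<Longrightarrow> (\<And>x. x \<in> S \<Longrightarrow> f x = g x) \<Longrightarrow> smooth_on S g"
  unfolding smooth_on_def using Ck_on_cong by metis

lemma smooth_on_const: "smooth_on S (\<lambda>x. c)"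
  unfolding smooth_on_def using Ck_on_const by blast

lemma smooth_on_add:
  "open S \<Longrightarrow> smooth_on S f \<Longrightarrow> smooth_on S g \<Longrightarrow> smooth_on S (\<lambda>x. f x + g x)"
  unfolding smooth_on_def using Ck_on_add by blast

lemma smooth_on_mult:
  fixes f g :: "'a::euclidean_space \<Rightarrow> real"
  shows "open S \<Longrightarrow> smooth_on S f \<Longrightarrow> smooth_on S g \<Longrightarrow> smooth_on S (\<lambda>x. f x * g x)"
  unfolding smooth_on_def using Ck_on_mult by blast

lemma smooth_on_inverse:
  fixes f :: "'a::euclidean_space \<Rightarrow> real"
  shows "open S \<Longrightarrow> smooth_on S f \<Longrightarrow> (\<And>x. x \<in> S \<Longrightarrow> f x \<noteq> 0) \<Longrightarrow> smooth_on S (\<lambda>x. inverse (f x))"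
  unfolding smooth_on_def using Ck_on_inverse by blast

lemma smooth_on_diff:
  fixes f g :: "'a::euclidean_space \<Rightarrow> real"
  assumes "open S" "smooth_on S f" "smooth_on S g"
  shows "smooth_on S (\<lambda>x. f x - g x)"
proof -
  have "smooth_on S (\<lambda>x. f x + (-1) * g x)"
    using assms by (intro smooth_on_add smooth_on_mult smooth_on_const)
  then show ?thesis by simp
qed

lemma smooth_on_divide:
  fixes f g :: "'a::euclidean_space \<Rightarrow> real"
  assumes "open S" "smooth_on S f" "smooth_on S g" "\<And>x. x \<in> S \<Longrightarrow> g x \<noteq> 0"
  shows "smooth_on S (\<lambda>x. f x / g x)"
  unfolding divide_inverse using assms by (intro smooth_on_mult smooth_on_inverse)

lemma smooth_on_sum:
  assumes "open S" "\<And>i. i \<in> I \<Longrightarrow> smooth_on S (f i)"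
  shows "smooth_on S (\<lambda>x. \<Sum>i\<in>I. f i x)"
  using assms(2)
  by (induction I rule: infinite_finite_induct) (auto intro: smooth_on_add smooth_on_const assms(1))

lemma smooth_on_prod:
  fixes f :: "'i \<Rightarrow> 'a::euclidean_space \<Rightarrow> real"
  assumes "open S" "\<And>i. i \<in> I \<Longrightarrow> smooth_on S (f i)"
  shows "smooth_on S (\<lambda>x. \<Prod>i\<in>I. f i x)"
  using assms(2)
  by (induction I rule: infinite_finite_induct) (auto intro: smooth_on_mult smooth_on_const assms(1))

lemma smooth_on_frechet:
  "smooth_on S f \<Longrightarrow> smooth_on S (\<lambda>x. frechet_derivative f (at x) v)"
  unfolding smooth_on_def by (metis Ck_on.simps(2))

lemma smooth_on_pderiv: "smooth_on S f \<Longrightarrow> smooth_on S (pderiv_at i f)"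
  unfolding pderiv_at_def by (rule smooth_on_frechet)

lemma smooth_on_differentiable: "smooth_on S f \<Longrightarrow> x \<in> S \<Longrightarrow> f differentiable (at x)"
  unfolding smooth_on_def by (metis Ck_on.simps(2))

lemma smooth_on_continuous_on: "smooth_on S f \<Longrightarrow> continuous_on S f"
  unfolding smooth_on_def by (metis Ck_on.simps(1))

lemma smooth_on_det:
  fixes M :: "'a::euclidean_space \<Rightarrow> real ^ 'n ^ 'n"
  assumes "open S" "\<And>i j. smooth_on S (\<lambda>x. M x $ i $ j)"
  shows "smooth_on S (\<lambda>x. det (M x))"
  unfolding det_def using assms
  by (intro smooth_on_sum smooth_on_mult smooth_on_const smooth_on_prod)

subsection \<open>Inverse matrices and Christoffel symbols\<close>

lemma matrix_inv_mult:
  fixes M :: "real ^ 'n ^ 'n"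
  assumes "invertible M"
  shows "M ** matrix_inv M = mat 1" "matrix_inv M ** M = mat 1"
proof -
  have "M ** matrix_inv M = mat 1 \<and> matrix_inv M ** M = mat 1"
    unfolding matrix_inv_def using assms unfolding invertible_def by (rule someI_ex)
  then show "M ** matrix_inv M = mat 1" "matrix_inv M ** M = mat 1" by auto
qed

lemma matrix_inv_unique_left:
  fixes M :: "real ^ 'n ^ 'n"
  assumes "B ** M = mat 1"
  shows "matrix_inv M = B"
proof -
  have "invertible M" using assms invertible_left_inverse by blast
  then show ?thesis
    by (metis assms matrix_inv_mult(1) matrix_mul_assoc matrix_mul_lid matrix_mul_rid)
qed

text \<open>Smoothness of the inverse matrix is read off from Cramer's rule.\<close>

lemma smooth_on_matrix_inv:
  fixes M :: "'a::euclidean_space \<Rightarrow> real ^ 'n ^ 'n"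
  assumes "open S" "\<And>i j. smooth_on S (\<lambda>x. M x $ i $ j)" "\<And>x. x \<in> S \<Longrightarrow> invertible (M x)"
  shows "smooth_on S (\<lambda>x. matrix_inv (M x) $ k $ l)"
proof -
  have *: "smooth_on S (\<lambda>x. det (\<chi> i j. if j = k then axis l 1 $ i else M x $ i $ j) / det (M x))"
  proof (intro smooth_on_divide smooth_on_det assms)
    show "smooth_on S (\<lambda>x. (\<chi> i j. if j = k then axis l 1 $ i else M x $ i $ j) $ i $ j)" for i j
      using assms(2) by (cases "j = k") (auto intro: smooth_on_const)
    show "det (M x) \<noteq> 0" if "x \<in> S" for x
      using assms(3)[OF that] invertible_det_nz by blast
  qed
  show ?thesis
  proof (rule smooth_on_cong[OF assms(1) *])
    fix x assume x: "x \<in> S"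
    have "M x *v (matrix_inv (M x) *v axis l 1) = axis l 1"
      using matrix_inv_mult[OF assms(3)[OF x]] by (simp add: matrix_vector_mul_assoc)
    then have "matrix_inv (M x) *v axis l 1 =
        (\<chi> k. det (\<chi> i j. if j = k then axis l 1 $ i else M x $ i $ j) / det (M x))"
      using cramer assms(3)[OF x] invertible_det_nz by blast
    moreover have "(matrix_inv (M x) *v axis l 1) $ k = matrix_inv (M x) $ k $ l"
      by (simp add: matrix_vector_mul_component inner_axis)
    ultimately show "det (\<chi> i j. if j = k then axis l 1 $ i else M x $ i $ j) / det (M x)
        = matrix_inv (M x) $ k $ l"
      by (metis (no_types, lifting) vec_lambda_beta)
  qed
qed

lemma smooth_on_christoffel:
  assumes "open S" "\<And>i j. smooth_on S (\<lambda>x. G x $ i $ j)" "\<And>x. x \<in> S \<Longrightarrow> invertible (G x)"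
  shows "smooth_on S (christoffel G k i j)"
proof -
  have "smooth_on S (\<lambda>x. christoffel G k i j x)"
    unfolding christoffel_def using assms
    by (intro smooth_on_sum smooth_on_mult smooth_on_const smooth_on_add smooth_on_diff
        smooth_on_matrix_inv smooth_on_pderiv)
  then show ?thesis by simp
qed

subsection \<open>Partial derivatives\<close>

lemma frechet_pderiv:
  fixes f :: "real ^ 'n \<Rightarrow> real"
  assumes "f differentiable (at x)"
  shows "frechet_derivative f (at x) v = (\<Sum>i\<in>UNIV. v $ i * pderiv_at i f x)"
proof -
  have l: "linear (frechet_derivative f (at x))" by (rule linear_frechet_derivative[OF assms])
  have "frechet_derivative f (at x) v = frechet_derivative f (at x) (\<Sum>i\<in>UNIV. v $ i *\<^sub>R axis i 1)"
    using basis_expansion[of v] by (simp add: scalar_mult_eq_scaleR)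
  also have "\<dots> = (\<Sum>i\<in>UNIV. v $ i * pderiv_at i f x)"
    unfolding pderiv_at_def by (simp add: linear_sum[OF l] linear_scale[OF l])
  finally show ?thesis .
qed

lemma pderiv_atI: "(f has_derivative f') (at x) \<Longrightarrow> pderiv_at i f x = f' (axis i 1)"
  unfolding pderiv_at_def by (simp add: frechet_derivative_at[symmetric])

lemma pderiv_at_add:
  assumes "f differentiable (at x)" "g differentiable (at x)"
  shows "pderiv_at i (\<lambda>y. f y + g y) x = pderiv_at i f x + pderiv_at i g x"
  using pderiv_atI[OF has_derivative_add[OF assms[unfolded frechet_derivative_works]]]
  by (simp add: pderiv_at_def)

lemma pderiv_at_diff:
  assumes "f differentiable (at x)" "g differentiable (at x)"
  shows "pderiv_at i (\<lambda>y. f y - g y) x = pderiv_at i f x - pderiv_at i g x"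
  using pderiv_atI[OF has_derivative_diff[OF assms[unfolded frechet_derivative_works]]]
  by (simp add: pderiv_at_def)

lemma pderiv_at_mult:
  assumes "f differentiable (at x)" "g differentiable (at x)"
  shows "pderiv_at i (\<lambda>y. f y * g y) x = f x * pderiv_at i g x + pderiv_at i f x * g x"
  using pderiv_atI[OF has_derivative_mult[OF assms[unfolded frechet_derivative_works]]]
  by (simp add: pderiv_at_def)

lemma pderiv_at_const [simp]: "pderiv_at i (\<lambda>y. c) x = 0"
  unfolding pderiv_at_def by simp

lemma pderiv_at_cmult:
  "f differentiable (at x) \<Longrightarrow> pderiv_at i (\<lambda>y. c * f y) x = c * pderiv_at i f x"
  using pderiv_at_mult[of "\<lambda>y. c" x f i] by simp

lemma pderiv_at_inverse:
  assumes "f differentiable (at x)" "f x \<noteq> 0"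
  shows "pderiv_at i (\<lambda>y. inverse (f y)) x = - pderiv_at i f x / (f x)\<^sup>2"
  using pderiv_atI[OF Deriv.has_derivative_inverse[OF assms(2) assms(1)[unfolded frechet_derivative_works]]]
  by (simp add: pderiv_at_def power2_eq_square divide_inverse)

lemma pderiv_at_sum:
  "(\<And>k. k \<in> I \<Longrightarrow> f k differentiable (at x)) \<Longrightarrow>
   pderiv_at i (\<lambda>y. \<Sum>k\<in>I. f k y) x = (\<Sum>k\<in>I. pderiv_at i (f k) x)"
proof (induction I rule: infinite_finite_induct)
  case (insert a F)
  then show ?case by (simp add: pderiv_at_add)
qed auto

lemma pderiv_at_cong:
  assumes "open S" "x \<in> S" "\<And>y. y \<in> S \<Longrightarrow> f y = g y" "f differentiable (at x)"
  shows "pderiv_at i f x = pderiv_at i g x"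
  unfolding pderiv_at_def
  using frechet_derivative_transform_within_open[OF assms(4,1,2)] assms(3) by metis

section \<open>Local existence for ordinary differential equations\<close>

text \<open>A globally Lipschitz autonomous equation has a local solution through every point.  The solution
  is the fixed point of the integral operator on bounded continuous functions of the whole line; the
  time argument is clamped to \<open>[-\<epsilon>, \<epsilon>]\<close> to make the iterates bounded.\<close>

lemma picard_global:
  fixes F :: "'b::euclidean_space \<Rightarrow> 'b"
  assumes lip: "\<And>y z. norm (F y - F z) \<le> L * norm (y - z)"
  obtains \<epsilon> and u :: "real \<Rightarrow> 'b" where "\<epsilon> > 0" "u 0 = y0"
    "\<And>t. t \<in> {-\<epsilon><..<\<epsilon>} \<Longrightarrow> (u has_vector_derivative F (u t)) (at t)"
proof -
  have L: "L \<ge> 0"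
  proof -
    obtain b :: 'b where b: "norm b = 1" using nonempty_Basis norm_Basis by blast
    have "0 \<le> norm (F b - F 0)" by simp
    also have "\<dots> \<le> L * norm (b - 0)" by (rule lip)
    finally show ?thesis using b by simp
  qed
  \<comment> \<open>The operator below has Lipschitz constant at most \<open>3 * \<epsilon> * L\<close>.\<close>
  define \<epsilon> where "\<epsilon> = 1 / (6 * (L + 1))"
  have \<epsilon>: "\<epsilon> > 0" "3 * \<epsilon> * L \<le> 1 / 2" using L by (auto simp: \<epsilon>_def field_simps)
  have contF: "continuous_on UNIV F"
    by (rule lipschitz_on_continuous_on[of L]) (auto intro!: lipschitz_onI simp: dist_norm lip L)
  have cont: "continuous_on S (\<lambda>s. F (apply_bcontfun w s))" for S :: "real set" and w
    by (rule continuous_on_compose2[OF contF]) auto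
  \<comment> \<open>The difference of two integrals from \<open>-\<epsilon>\<close> plays the role of the oriented integral from \<open>0\<close> to \<open>t\<close>.\<close>
  define P where "P w t = y0 + integral {-\<epsilon>..t} (\<lambda>s. F (apply_bcontfun w s))
      - integral {-\<epsilon>..0} (\<lambda>s. F (apply_bcontfun w s))" for w :: "real \<Rightarrow>\<^sub>C 'b" and t
  have Pder: "(P w has_vector_derivative F (apply_bcontfun w t)) (at t within {-\<epsilon>..\<epsilon>})"
    if "t \<in> {-\<epsilon>..\<epsilon>}" for w t
    unfolding P_def using integral_has_vector_derivative[OF cont that]
    by (auto intro!: derivative_eq_intros)
  have Pcont: "continuous_on (cbox (-\<epsilon>) \<epsilon>) (P w)" for w
    using Pder[of _ w] has_vector_derivative_continuous continuous_on_eq_continuous_within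
    by (metis interval_cbox)
  have "\<exists>g::real \<Rightarrow>\<^sub>C 'b. \<forall>t. apply_bcontfun g t = P w (clamp (-\<epsilon>) \<epsilon> t)" for w
    using continuous_on_cbox_bcontfunE[OF Pcont[of w]] by metis
  then obtain \<Phi> :: "(real \<Rightarrow>\<^sub>C 'b) \<Rightarrow> (real \<Rightarrow>\<^sub>C 'b)"
    where \<Phi>: "\<And>w t. apply_bcontfun (\<Phi> w) t = P w (clamp (-\<epsilon>) \<epsilon> t)" by metis
  have int: "norm (integral {-\<epsilon>..t} (\<lambda>s. F (apply_bcontfun w s)) - integral {-\<epsilon>..t} (\<lambda>s. F (apply_bcontfun z s)))
      \<le> L * dist w z * (t + \<epsilon>)" if t: "t \<in> {-\<epsilon>..\<epsilon>}" for w z t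
  proof -
    have "integral {-\<epsilon>..t} (\<lambda>s. F (apply_bcontfun w s)) - integral {-\<epsilon>..t} (\<lambda>s. F (apply_bcontfun z s))
        = integral {-\<epsilon>..t} (\<lambda>s. F (apply_bcontfun w s) - F (apply_bcontfun z s))"
      by (rule integral_diff[symmetric]) (intro integrable_continuous_real cont)+
    also have "norm \<dots> \<le> L * dist w z * (t - (-\<epsilon>))"
    proof (rule integral_bound)
      show "norm (F (apply_bcontfun w s) - F (apply_bcontfun z s)) \<le> L * dist w z" for s
        using lip[of "apply_bcontfun w s" "apply_bcontfun z s"] dist_bounded[of w s z] L
        by (metis dist_norm mult_left_mono order_trans)
      show "continuous_on {-\<epsilon>..t} (\<lambda>s. F (apply_bcontfun w s) - F (apply_bcontfun z s))"
        by (intro continuous_intros cont)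
    qed (use t in auto)
    finally show ?thesis by (simp add: algebra_simps)
  qed
  have contr: "dist (\<Phi> w) (\<Phi> z) \<le> 1 / 2 * dist w z" for w z
  proof (rule dist_bound)
    fix t
    let ?c = "clamp (-\<epsilon>) \<epsilon> t"
    have c: "?c \<in> {-\<epsilon>..\<epsilon>}" using clamp_in_interval[of "-\<epsilon>" \<epsilon> t] \<epsilon> by simp
    have "dist (apply_bcontfun (\<Phi> w) t) (apply_bcontfun (\<Phi> z) t)
      = norm ((integral {-\<epsilon>..?c} (\<lambda>s. F (apply_bcontfun w s)) - integral {-\<epsilon>..?c} (\<lambda>s. F (apply_bcontfun z s)))
      - (integral {-\<epsilon>..0} (\<lambda>s. F (apply_bcontfun w s)) - integral {-\<epsilon>..0} (\<lambda>s. F (apply_bcontfun z s))))"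
      unfolding \<Phi> P_def dist_norm by (simp add: algebra_simps)
    also have "\<dots> \<le> L * dist w z * (?c + \<epsilon>) + L * dist w z * (0 + \<epsilon>)"
      by (rule order_trans[OF norm_triangle_ineq4 add_mono[OF int[OF c] int]]) (use \<epsilon>(1) in auto)
    also have "\<dots> \<le> L * dist w z * (2 * \<epsilon>) + L * dist w z * (0 + \<epsilon>)"
      using c L by (intro add_mono mult_left_mono) auto
    also have "\<dots> = (3 * \<epsilon> * L) * dist w z" by (simp add: algebra_simps)
    also have "\<dots> \<le> 1 / 2 * dist w z" using \<epsilon>(2) by (intro mult_right_mono) auto
    finally show "dist (apply_bcontfun (\<Phi> w) t) (apply_bcontfun (\<Phi> z) t) \<le> 1 / 2 * dist w z" .
  qed
  obtain w where w: "\<Phi> w = w"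
    using banach_fix_type[of "1/2" \<Phi>] contr by auto
  have wP: "apply_bcontfun w t = P w t" if "t \<in> {-\<epsilon>..\<epsilon>}" for t
    using \<Phi>[of w t] that by (simp add: w)
  have der: "(apply_bcontfun w has_vector_derivative F (apply_bcontfun w t)) (at t)"
    if t: "t \<in> {-\<epsilon><..<\<epsilon>}" for t
  proof (rule has_vector_derivative_transform_within_open[OF _ _ t])
    have "(P w has_vector_derivative F (apply_bcontfun w t)) (at t within {-\<epsilon><..<\<epsilon>})"
      by (rule has_vector_derivative_within_subset[OF Pder]) (use t in auto)
    then show "(P w has_vector_derivative F (apply_bcontfun w t)) (at t)"
      by (simp only: at_within_open[OF t open_greaterThanLessThan])
    show "P w s = apply_bcontfun w s" if "s \<in> {-\<epsilon><..<\<epsilon>}" for s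
      using wP[of s] that by auto
  qed simp
  have "apply_bcontfun w 0 = y0" using wP[of 0] \<epsilon>(1) by (simp add: P_def)
  then show ?thesis using that[OF \<epsilon>(1)] der by blast
qed

text \<open>A field that is Lipschitz on a closed ball extends to a globally Lipschitz field, by composing
  it with the nearest-point retraction onto the ball.\<close>

lemma picard_local:
  fixes F :: "'b::euclidean_space \<Rightarrow> 'b"
  assumes r: "r > 0"
    and lip: "\<And>y z. y \<in> cball y0 r \<Longrightarrow> z \<in> cball y0 r \<Longrightarrow> norm (F y - F z) \<le> L * norm (y - z)"
  obtains \<epsilon> and u :: "real \<Rightarrow> 'b" where "\<epsilon> > 0" "u 0 = y0"
    "\<And>t. t \<in> {-\<epsilon><..<\<epsilon>} \<Longrightarrow> u t \<in> cball y0 r"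
    "\<And>t. t \<in> {-\<epsilon><..<\<epsilon>} \<Longrightarrow> (u has_vector_derivative F (u t)) (at t)"
proof -
  let ?C = "cball y0 r"
  let ?c = "closest_point ?C"
  have C: "convex ?C" "closed ?C" "?C \<noteq> {}" using r by auto
  have inC: "?c y \<in> ?C" for y using closest_point_in_set[OF C(2,3)] .
  have L: "L \<ge> 0"
  proof -
    obtain b :: 'b where b: "norm b = 1" using nonempty_Basis norm_Basis by blast
    have "0 \<le> norm (F (y0 + r *\<^sub>R b) - F y0)" by simp
    also have "\<dots> \<le> L * norm (y0 + r *\<^sub>R b - y0)"
      using r b by (intro lip) (auto simp: dist_norm)
    finally show ?thesis using b r by (simp add: zero_le_mult_iff)
  qed
  have "norm (F (?c y) - F (?c z)) \<le> L * norm (y - z)" for y z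
  proof -
    have "norm (F (?c y) - F (?c z)) \<le> L * norm (?c y - ?c z)" by (intro lip inC)
    also have "\<dots> \<le> L * norm (y - z)"
      using closest_point_lipschitz[OF C, of y z] L by (simp add: dist_norm mult_left_mono)
    finally show ?thesis .
  qed
  then obtain \<epsilon> u where \<epsilon>: "\<epsilon> > 0" and u0: "u 0 = y0"
    and der: "\<And>t. t \<in> {-\<epsilon><..<\<epsilon>} \<Longrightarrow> (u has_vector_derivative F (?c (u t))) (at t)"
    using picard_global[of "\<lambda>y. F (?c y)" L y0] by blast
  have "continuous (at 0) u"
    using der[of 0] \<epsilon> has_vector_derivative_continuous by auto
  then obtain d where d: "d > 0" "\<And>t. dist t 0 < d \<Longrightarrow> dist (u t) (u 0) < r"
    using r unfolding continuous_at_eps_delta by blast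
  have in2: "u t \<in> ?C" if "t \<in> {- min \<epsilon> d<..<min \<epsilon> d}" for t
    using d(2)[of t] that u0 by (auto simp: dist_commute dist_real_def less_imp_le)
  show ?thesis
  proof (rule that[of "min \<epsilon> d" u])
    fix t assume t: "t \<in> {- min \<epsilon> d<..<min \<epsilon> d}"
    show "(u has_vector_derivative F (u t)) (at t)"
      using der[of t] t closest_point_self[OF in2[OF t]] by auto
  qed (use \<epsilon> d u0 in2 in auto)
qed

section \<open>The Ricci tensor under a conformal change of the metric\<close>

text \<open>The part of the coordinate expression for \<open>Ric(v, v)\<close> that is quadratic in the Christoffel symbols
  \<open>\<Gamma> k i j\<close> (upper index first).\<close>

definition ricci_quad :: "('n \<Rightarrow> 'n \<Rightarrow> 'n \<Rightarrow> real) \<Rightarrow> ('n \<Rightarrow> real) \<Rightarrow> real" where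
  "ricci_quad \<Gamma> v = (\<Sum>j\<in>UNIV. \<Sum>k\<in>UNIV. v j * v k *
     (\<Sum>i\<in>UNIV. \<Sum>m\<in>UNIV. \<Gamma> i i m * \<Gamma> m j k - \<Gamma> i j m * \<Gamma> m i k))"

text \<open>In terms of the matrix \<open>A = \<Gamma>(v)\<close> the quadratic part is \<open>tr \<Gamma> (\<Gamma>(v, v)) - tr (A A)\<close>.\<close>

lemma ricci_quad_alt:
  fixes \<Gamma> :: "'n::finite \<Rightarrow> 'n \<Rightarrow> 'n \<Rightarrow> real"
  assumes sym: "\<And>i j k. \<Gamma> k i j = \<Gamma> k j i"
  shows "ricci_quad \<Gamma> v =
     (\<Sum>m\<in>UNIV. (\<Sum>i\<in>UNIV. \<Gamma> i i m) * (\<Sum>j\<in>UNIV. \<Sum>k\<in>UNIV. v j * v k * \<Gamma> m j k))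
   - (\<Sum>i\<in>UNIV. \<Sum>m\<in>UNIV. (\<Sum>j\<in>UNIV. v j * \<Gamma> i j m) * (\<Sum>j\<in>UNIV. v j * \<Gamma> m j i))"
proof -
  have 1: "(\<Sum>j\<in>UNIV. \<Sum>k\<in>UNIV. v j * v k * (\<Sum>i\<in>UNIV. \<Sum>m\<in>UNIV. \<Gamma> i i m * \<Gamma> m j k))
    = (\<Sum>m\<in>UNIV. (\<Sum>i\<in>UNIV. \<Gamma> i i m) * (\<Sum>j\<in>UNIV. \<Sum>k\<in>UNIV. v j * v k * \<Gamma> m j k))"
    (is "?l = ?r")
  proof -
    have "?l = (\<Sum>j\<in>UNIV. \<Sum>k\<in>UNIV. \<Sum>i\<in>UNIV. \<Sum>m\<in>UNIV. v j * v k * (\<Gamma> i i m * \<Gamma> m j k))"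
      by (simp add: sum_distrib_left)
    also have "\<dots> = (\<Sum>j\<in>UNIV. \<Sum>k\<in>UNIV. \<Sum>m\<in>UNIV. \<Sum>i\<in>UNIV. v j * v k * (\<Gamma> i i m * \<Gamma> m j k))"
      by (intro sum.cong refl sum.swap)
    also have "\<dots> = (\<Sum>j\<in>UNIV. \<Sum>m\<in>UNIV. \<Sum>k\<in>UNIV. \<Sum>i\<in>UNIV. v j * v k * (\<Gamma> i i m * \<Gamma> m j k))"
      by (intro sum.cong refl sum.swap)
    also have "\<dots> = (\<Sum>m\<in>UNIV. \<Sum>j\<in>UNIV. \<Sum>k\<in>UNIV. \<Sum>i\<in>UNIV. v j * v k * (\<Gamma> i i m * \<Gamma> m j k))"
      by (rule sum.swap)
    also have "\<dots> = ?r"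
      by (simp add: sum_distrib_left sum_distrib_right mult.commute mult.left_commute)
    finally show ?thesis .
  qed
  have 2: "(\<Sum>j\<in>UNIV. \<Sum>k\<in>UNIV. v j * v k * (\<Sum>i\<in>UNIV. \<Sum>m\<in>UNIV. \<Gamma> i j m * \<Gamma> m i k))
    = (\<Sum>i\<in>UNIV. \<Sum>m\<in>UNIV. (\<Sum>j\<in>UNIV. v j * \<Gamma> i j m) * (\<Sum>k\<in>UNIV. v k * \<Gamma> m k i))"
    (is "?l = ?r")
  proof -
    have "?l = (\<Sum>j\<in>UNIV. \<Sum>k\<in>UNIV. \<Sum>i\<in>UNIV. \<Sum>m\<in>UNIV. v j * v k * (\<Gamma> i j m * \<Gamma> m i k))"
      by (simp add: sum_distrib_left)
    also have "\<dots> = (\<Sum>j\<in>UNIV. \<Sum>i\<in>UNIV. \<Sum>k\<in>UNIV. \<Sum>m\<in>UNIV. v j * v k * (\<Gamma> i j m * \<Gamma> m i k))"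
      by (intro sum.cong refl sum.swap)
    also have "\<dots> = (\<Sum>i\<in>UNIV. \<Sum>j\<in>UNIV. \<Sum>k\<in>UNIV. \<Sum>m\<in>UNIV. v j * v k * (\<Gamma> i j m * \<Gamma> m i k))"
      by (rule sum.swap)
    also have "\<dots> = (\<Sum>i\<in>UNIV. \<Sum>j\<in>UNIV. \<Sum>m\<in>UNIV. \<Sum>k\<in>UNIV. v j * v k * (\<Gamma> i j m * \<Gamma> m i k))"
      by (intro sum.cong refl sum.swap)
    also have "\<dots> = (\<Sum>i\<in>UNIV. \<Sum>m\<in>UNIV. \<Sum>j\<in>UNIV. \<Sum>k\<in>UNIV. v j * v k * (\<Gamma> i j m * \<Gamma> m i k))"
      by (intro sum.cong refl sum.swap)
    also have "\<dots> = ?r"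
      unfolding sum_product using sym by (intro sum.cong refl) (simp add: mult_ac)
    finally show ?thesis .
  qed
  show ?thesis
    unfolding ricci_quad_def 1[symmetric] 2[symmetric]
    by (simp add: sum_subtractf right_diff_distrib)
qed

text \<open>The tensor algebra at one point.  Here \<open>\<Gamma>\<close> and \<open>G\<close> are the values of the Christoffel symbols and of the
  metric, \<open>dG i j k\<close> is the derivative of \<open>G j k\<close> in direction \<open>i\<close>, \<open>f\<close> is the differential of
  \<open>ln \<bar>\<psi>\<bar>\<close>, \<open>F\<close> is its gradient, and \<open>v\<close> is a null vector.\<close>

locale conformal_point =
  fixes \<Gamma> :: "'n::finite \<Rightarrow> 'n \<Rightarrow> 'n \<Rightarrow> real" and dG :: "'n \<Rightarrow> 'n \<Rightarrow> 'n \<Rightarrow> real"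
    and G :: "'n \<Rightarrow> 'n \<Rightarrow> real" and f F v :: "'n \<Rightarrow> real"
  assumes \<Gamma>_sym: "\<Gamma> k i j = \<Gamma> k j i"
    and G_sym: "G i j = G j i"
    and raise: "(\<Sum>j\<in>UNIV. G i j * F j) = f i"
    and compat: "dG i j k = (\<Sum>m\<in>UNIV. G m k * \<Gamma> m i j + G j m * \<Gamma> m i k)"
    and null: "(\<Sum>i\<in>UNIV. \<Sum>j\<in>UNIV. v i * v j * G i j) = 0"
begin

text \<open>The tensor \<open>T\<close> is the change of the Christoffel symbols.  The matrices \<open>A\<close> and \<open>B\<close> are the
  contractions of \<open>\<Gamma>\<close> and \<open>T\<close> with \<open>v\<close>, \<open>av\<close> is the double contraction of \<open>\<Gamma>\<close> with \<open>v\<close>, \<open>tr\<close> is the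
  trace of \<open>\<Gamma>\<close>, \<open>fv\<close> is \<open>f(v)\<close>, and \<open>vl\<close> is \<open>v\<close> with its index lowered.\<close>

definition T where
  "T k i j = - (if k = i then f j else 0) - (if k = j then f i else 0) + G i j * F k"
definition A where "A i m = (\<Sum>j\<in>UNIV. v j * \<Gamma> i j m)"
definition av where "av m = (\<Sum>j\<in>UNIV. \<Sum>k\<in>UNIV. v j * v k * \<Gamma> m j k)"
definition tr where "tr m = (\<Sum>i\<in>UNIV. \<Gamma> i i m)"
definition fv where "fv = (\<Sum>i\<in>UNIV. v i * f i)"
definition vl where "vl m = (\<Sum>j\<in>UNIV. v j * G j m)"
definition B where "B i m = (\<Sum>j\<in>UNIV. v j * T i j m)"

lemma T_sym: "T k i j = T k j i"
  unfolding T_def using G_sym[of i j] by simp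

text \<open>Up to a multiple of the identity \<open>B\<close> is a sum of two matrices of rank one, which makes all traces
  below explicit.\<close>

lemma B_eq: "B i m = - (v i * f m) - (if i = m then fv else 0) + F i * vl m"
proof -
  have "B i m = (\<Sum>j\<in>UNIV. (if i = j then - (v j * f m) else 0)) + (\<Sum>j\<in>UNIV. (if i = m then - (v j * f j) else 0))
      + (\<Sum>j\<in>UNIV. v j * G j m * F i)"
    unfolding B_def T_def sum.distrib[symmetric]
    by (intro sum.cong refl) (auto simp: algebra_simps)
  also have "(\<Sum>j\<in>UNIV. (if i = m then - (v j * f j) else 0)) = (if i = m then - fv else 0)"
    by (simp add: fv_def sum_negf)
  also have "(\<Sum>j\<in>UNIV. (if i = j then - (v j * f m) else 0)) = - (v i * f m)"
    by simp
  also have "(\<Sum>j\<in>UNIV. v j * G j m * F i) = F i * vl m"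
    by (simp add: vl_def sum_distrib_left mult_ac)
  finally show ?thesis by simp
qed

lemma vl_F: "(\<Sum>m\<in>UNIV. vl m * F m) = fv"
proof -
  have "(\<Sum>m\<in>UNIV. vl m * F m) = (\<Sum>m\<in>UNIV. \<Sum>j\<in>UNIV. v j * (G j m * F m))"
    by (simp add: vl_def sum_distrib_left sum_distrib_right mult_ac)
  also have "\<dots> = (\<Sum>j\<in>UNIV. \<Sum>m\<in>UNIV. v j * (G j m * F m))" by (rule sum.swap)
  also have "\<dots> = fv" by (simp add: sum_distrib_left[symmetric] raise fv_def)
  finally show ?thesis .
qed

lemma vl_v: "(\<Sum>m\<in>UNIV. vl m * v m) = 0"
proof -
  have "(\<Sum>m\<in>UNIV. vl m * v m) = (\<Sum>m\<in>UNIV. \<Sum>j\<in>UNIV. v m * v j * G m j)"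
    by (simp add: vl_def sum_distrib_left sum_distrib_right mult_ac G_sym)
  then show ?thesis using null by simp
qed

lemma B_left: "(\<Sum>i\<in>UNIV. c i * B i m) =
    - (\<Sum>i\<in>UNIV. c i * v i) * f m - c m * fv + (\<Sum>i\<in>UNIV. c i * F i) * vl m"
proof -
  have "(\<Sum>i\<in>UNIV. c i * B i m) =
    (\<Sum>i\<in>UNIV. - (c i * v i * f m)) + (\<Sum>i\<in>UNIV. (if i = m then - (c i * fv) else 0)) + (\<Sum>i\<in>UNIV. c i * F i * vl m)"
    unfolding B_eq sum.distrib[symmetric]
    by (intro sum.cong refl) (auto simp: algebra_simps)
  also have "(\<Sum>i\<in>UNIV. (if i = m then - (c i * fv) else 0)) = - (c m * fv)"
    by simp
  finally show ?thesis by (simp add: sum_negf sum_distrib_right)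
qed

lemma trace_B_B: "(\<Sum>i\<in>UNIV. \<Sum>m\<in>UNIV. B i m * B m i) = (real CARD('n) + 2) * fv\<^sup>2"
proof -
  have "(\<Sum>m\<in>UNIV. B i m * B m i) = 2 * fv * (v i * f i) - (\<Sum>m\<in>UNIV. f m * F m) * (v i * vl i)
      - fv * B i i" for i
  proof -
    have e: "(\<Sum>m\<in>UNIV. B i m * v m) = - (v i * fv) - v i * fv"
    proof -
      have "(\<Sum>m\<in>UNIV. B i m * v m) = (\<Sum>m\<in>UNIV. - (v i * (v m * f m)))
         + (\<Sum>m\<in>UNIV. (if i = m then - (fv * v m) else 0)) + (\<Sum>m\<in>UNIV. F i * (vl m * v m))"
        unfolding B_eq sum.distrib[symmetric] by (intro sum.cong refl) (auto simp: algebra_simps)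
      also have "(\<Sum>m\<in>UNIV. (if i = m then - (fv * v m) else 0)) = - (fv * v i)" by simp
      finally show ?thesis
        by (simp add: sum_negf sum_distrib_left[symmetric] vl_v fv_def[symmetric])
    qed
    have e2: "(\<Sum>m\<in>UNIV. B i m * F m) = - (v i * (\<Sum>m\<in>UNIV. f m * F m))"
    proof -
      have "(\<Sum>m\<in>UNIV. B i m * F m) = (\<Sum>m\<in>UNIV. - (v i * (f m * F m)))
         + (\<Sum>m\<in>UNIV. (if i = m then - (fv * F m) else 0)) + (\<Sum>m\<in>UNIV. F i * (vl m * F m))"
        unfolding B_eq sum.distrib[symmetric] by (intro sum.cong refl) (auto simp: algebra_simps)
      also have "(\<Sum>m\<in>UNIV. (if i = m then - (fv * F m) else 0)) = - (fv * F i)" by simp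
      finally show ?thesis
        by (simp add: sum_negf sum_distrib_left[symmetric] vl_F mult.commute[of fv])
    qed
    show ?thesis
      using B_left[of "B i" i] unfolding e e2 by (simp add: algebra_simps)
  qed
  then have "(\<Sum>i\<in>UNIV. \<Sum>m\<in>UNIV. B i m * B m i) = 2 * fv * (\<Sum>i\<in>UNIV. v i * f i)
      - (\<Sum>m\<in>UNIV. f m * F m) * (\<Sum>i\<in>UNIV. v i * vl i) - fv * (\<Sum>i\<in>UNIV. B i i)"
    by (simp add: sum_subtractf sum_distrib_left)
  also have "(\<Sum>i\<in>UNIV. v i * vl i) = 0" using vl_v by (simp add: mult.commute)
  also have "(\<Sum>i\<in>UNIV. v i * f i) = fv" by (simp add: fv_def)
  also have "(\<Sum>i\<in>UNIV. B i i) = - real CARD('n) * fv"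
    unfolding B_eq using vl_F
    by (simp add: sum.distrib sum_subtractf sum_negf fv_def[symmetric] mult.commute[of "F i" "vl i" for i])
  finally show ?thesis by (simp add: power2_eq_square algebra_simps)
qed

lemma A_apply_v: "(\<Sum>m\<in>UNIV. A i m * v m) = av i"
proof -
  have "(\<Sum>m\<in>UNIV. A i m * v m) = (\<Sum>m\<in>UNIV. \<Sum>j\<in>UNIV. v m * v j * \<Gamma> i m j)"
    by (simp add: A_def sum_distrib_left sum_distrib_right mult_ac \<Gamma>_sym)
  then show ?thesis by (simp add: av_def)
qed

lemma trace_A: "(\<Sum>i\<in>UNIV. A i i) = (\<Sum>m\<in>UNIV. v m * tr m)"
proof -
  have "(\<Sum>i\<in>UNIV. A i i) = (\<Sum>i\<in>UNIV. \<Sum>j\<in>UNIV. v j * \<Gamma> i i j)"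
    by (simp add: A_def \<Gamma>_sym)
  also have "\<dots> = (\<Sum>j\<in>UNIV. \<Sum>i\<in>UNIV. v j * \<Gamma> i i j)" by (rule sum.swap)
  finally show ?thesis by (simp add: tr_def sum_distrib_left)
qed

lemma trace_A_B: "(\<Sum>i\<in>UNIV. \<Sum>m\<in>UNIV. A i m * B m i) =
    - (\<Sum>i\<in>UNIV. av i * f i) - fv * (\<Sum>m\<in>UNIV. v m * tr m) + (\<Sum>i\<in>UNIV. \<Sum>m\<in>UNIV. A i m * F m * vl i)"
proof -
  have "(\<Sum>m\<in>UNIV. A i m * B m i) = - (av i * f i) - fv * A i i + (\<Sum>m\<in>UNIV. A i m * F m * vl i)" for i
    using B_left[of "A i" i] unfolding A_apply_v by (simp add: sum_distrib_right[symmetric] mult.commute[of fv])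
  then show ?thesis
    by (simp add: sum_subtractf sum.distrib sum_negf sum_distrib_left[symmetric] trace_A)
qed

lemma trace_B_A: "(\<Sum>i\<in>UNIV. \<Sum>m\<in>UNIV. B i m * A m i) = (\<Sum>i\<in>UNIV. \<Sum>m\<in>UNIV. A i m * B m i)"
  using sum.swap[of "\<lambda>i m. B i m * A m i" UNIV UNIV] by (simp add: mult.commute)

lemma T_trace: "(\<Sum>i\<in>UNIV. T i i m) = - real CARD('n) * f m"
proof -
  have "(\<Sum>i\<in>UNIV. T i i m) = (\<Sum>i\<in>(UNIV::'n set). - f m) + (\<Sum>i\<in>UNIV. (if i = m then - f i else 0))
      + (\<Sum>i\<in>UNIV. G m i * F i)"
    unfolding T_def sum.distrib[symmetric] by (intro sum.cong refl) (auto simp: G_sym)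
  also have "(\<Sum>i\<in>UNIV. (if i = m then - f i else 0)) = - f m" by simp
  finally show ?thesis by (simp add: raise)
qed

lemma T_vv: "(\<Sum>j\<in>UNIV. \<Sum>k\<in>UNIV. v j * v k * T m j k) = - 2 * v m * fv"
proof -
  have "(\<Sum>j\<in>UNIV. \<Sum>k\<in>UNIV. v j * v k * T m j k) = (\<Sum>k\<in>UNIV. v k * B m k)"
    unfolding B_def sum_distrib_left
    by (subst sum.swap) (simp add: mult_ac)
  also have "\<dots> = (\<Sum>k\<in>UNIV. - (v m * (v k * f k)))
         + (\<Sum>k\<in>UNIV. (if m = k then - (fv * v k) else 0)) + (\<Sum>k\<in>UNIV. F m * (vl k * v k))"
    unfolding B_eq sum.distrib[symmetric] by (intro sum.cong refl) (auto simp: algebra_simps)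
  also have "(\<Sum>k\<in>UNIV. (if m = k then - (fv * v k) else 0)) = - (fv * v m)" by simp
  finally show ?thesis
    by (simp add: sum_negf sum_distrib_left[symmetric] vl_v fv_def[symmetric])
qed

lemma dG_F: "(\<Sum>i\<in>UNIV. F i * (\<Sum>j\<in>UNIV. \<Sum>k\<in>UNIV. v j * v k * dG i j k)) =
    2 * (\<Sum>i\<in>UNIV. \<Sum>m\<in>UNIV. A i m * F m * vl i)"
proof -
  have "(\<Sum>j\<in>UNIV. \<Sum>k\<in>UNIV. v j * v k * dG i j k) = 2 * (\<Sum>m\<in>UNIV. vl m * A m i)" for i
  proof -
    have a: "(\<Sum>j\<in>UNIV. \<Sum>k\<in>UNIV. \<Sum>m\<in>UNIV. v j * v k * (G j m * \<Gamma> m i k)) = (\<Sum>m\<in>UNIV. vl m * A m i)"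
    proof -
      have "(\<Sum>j\<in>UNIV. \<Sum>k\<in>UNIV. \<Sum>m\<in>UNIV. v j * v k * (G j m * \<Gamma> m i k))
        = (\<Sum>j\<in>UNIV. \<Sum>m\<in>UNIV. \<Sum>k\<in>UNIV. v j * v k * (G j m * \<Gamma> m i k))"
        by (intro sum.cong refl sum.swap)
      also have "\<dots> = (\<Sum>m\<in>UNIV. \<Sum>j\<in>UNIV. \<Sum>k\<in>UNIV. v j * v k * (G j m * \<Gamma> m i k))"
        by (rule sum.swap)
      also have "\<dots> = (\<Sum>m\<in>UNIV. vl m * A m i)"
        unfolding vl_def A_def sum_product by (intro sum.cong refl) (simp add: mult_ac \<Gamma>_sym)
      finally show ?thesis .
    qed
    have b: "(\<Sum>j\<in>UNIV. \<Sum>k\<in>UNIV. \<Sum>m\<in>UNIV. v j * v k * (G m k * \<Gamma> m i j))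
        = (\<Sum>j\<in>UNIV. \<Sum>k\<in>UNIV. \<Sum>m\<in>UNIV. v j * v k * (G j m * \<Gamma> m i k))"
      by (subst sum.swap) (simp add: mult_ac G_sym)
    show ?thesis
      using a b unfolding compat by (simp add: sum.distrib distrib_left sum_distrib_left)
  qed
  then have "(\<Sum>i\<in>UNIV. F i * (\<Sum>j\<in>UNIV. \<Sum>k\<in>UNIV. v j * v k * dG i j k)) =
    2 * (\<Sum>i\<in>UNIV. \<Sum>m\<in>UNIV. A m i * F i * vl m)"
    by (simp add: sum_distrib_left mult_ac)
  also have "(\<Sum>i\<in>UNIV. \<Sum>m\<in>UNIV. A m i * F i * vl m) = (\<Sum>i\<in>UNIV. \<Sum>m\<in>UNIV. A i m * F m * vl i)"
    by (rule sum.swap)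
  finally show ?thesis .
qed

text \<open>The last summand on the left comes from the divergence of the third term of \<open>T\<close>, as the part in which
  the derivative falls on the metric; together with the trace of \<open>A B\<close> it leaves only terms that are proportional to \<open>n - 2\<close>.\<close>

lemma ricci_quad_change:
  "ricci_quad (\<lambda>k i j. \<Gamma> k i j + T k i j) v - ricci_quad \<Gamma> v
     + (\<Sum>i\<in>UNIV. F i * (\<Sum>j\<in>UNIV. \<Sum>k\<in>UNIV. v j * v k * dG i j k))
   = (real CARD('n) - 2) * (fv\<^sup>2 - (\<Sum>m\<in>UNIV. f m * av m))"
proof -
  have sym: "\<Gamma> k i j + T k i j = \<Gamma> k j i + T k j i" for k i j
    using \<Gamma>_sym T_sym by metis
  have e: "(\<Sum>m\<in>UNIV. (\<Sum>i\<in>UNIV. \<Gamma> i i m + T i i m) * (\<Sum>j\<in>UNIV. \<Sum>k\<in>UNIV. v j * v k * (\<Gamma> m j k + T m j k)))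
    = (\<Sum>m\<in>UNIV. (tr m - real CARD('n) * f m) * (av m - 2 * v m * fv))"
    by (simp add: distrib_left sum.distrib T_trace T_vv tr_def[symmetric] av_def[symmetric])
  have e2: "(\<Sum>i\<in>UNIV. \<Sum>m\<in>UNIV. (\<Sum>j\<in>UNIV. v j * (\<Gamma> i j m + T i j m)) * (\<Sum>j\<in>UNIV. v j * (\<Gamma> m j i + T m j i)))
    = (\<Sum>i\<in>UNIV. \<Sum>m\<in>UNIV. (A i m + B i m) * (A m i + B m i))"
    by (simp add: distrib_left sum.distrib A_def[symmetric] B_def[symmetric])
  have e3: "(\<Sum>i\<in>UNIV. \<Sum>m\<in>UNIV. (A i m + B i m) * (A m i + B m i)) =
     (\<Sum>i\<in>UNIV. \<Sum>m\<in>UNIV. A i m * A m i) + 2 * (\<Sum>i\<in>UNIV. \<Sum>m\<in>UNIV. A i m * B m i)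
     + (real CARD('n) + 2) * fv\<^sup>2"
    using trace_B_A trace_B_B by (simp add: algebra_simps sum.distrib)
  have e4: "(\<Sum>m\<in>UNIV. (tr m - real CARD('n) * f m) * (av m - 2 * v m * fv))
    = (\<Sum>m\<in>UNIV. tr m * av m) - 2 * fv * (\<Sum>m\<in>UNIV. v m * tr m)
      - real CARD('n) * (\<Sum>m\<in>UNIV. f m * av m) + 2 * real CARD('n) * fv * (\<Sum>m\<in>UNIV. v m * f m)"
    by (simp add: algebra_simps sum.distrib sum_subtractf sum_distrib_left sum_negf)
  have e5: "ricci_quad \<Gamma> v = (\<Sum>m\<in>UNIV. tr m * av m) - (\<Sum>i\<in>UNIV. \<Sum>m\<in>UNIV. A i m * A m i)"
    using ricci_quad_alt[of \<Gamma> v, OF \<Gamma>_sym] unfolding tr_def av_def A_def .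
  have e6: "(\<Sum>i\<in>UNIV. av i * f i) = (\<Sum>m\<in>UNIV. f m * av m)" by (simp add: mult.commute)
  have e7: "(\<Sum>m\<in>UNIV. v m * f m) = fv" by (simp add: fv_def)
  have "ricci_quad (\<lambda>k i j. \<Gamma> k i j + T k i j) v =
     (\<Sum>m\<in>UNIV. tr m * av m) - 2 * fv * (\<Sum>m\<in>UNIV. v m * tr m)
      - real CARD('n) * (\<Sum>m\<in>UNIV. f m * av m) + 2 * real CARD('n) * fv * fv
     - ((\<Sum>i\<in>UNIV. \<Sum>m\<in>UNIV. A i m * A m i) + 2 * (\<Sum>i\<in>UNIV. \<Sum>m\<in>UNIV. A i m * B m i)
     + (real CARD('n) + 2) * fv\<^sup>2)"
    unfolding ricci_quad_alt[of "\<lambda>k i j. \<Gamma> k i j + T k i j" v, OF sym] e e2 e3 e4 e7 ..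
  then show ?thesis
    unfolding e5 trace_A_B dG_F e6 by (simp add: algebra_simps power2_eq_square)
qed

end

subsection \<open>Metric compatibility\<close>

lemma christoffel_sym:
  assumes "\<And>k i j. pderiv_at k (\<lambda>y. G y $ i $ j) x = pderiv_at k (\<lambda>y. G y $ j $ i) x"
  shows "christoffel G k i j x = christoffel G k j i x"
  unfolding christoffel_def using assms[of _ i j] by (simp add: add.commute)

lemma matrix_inv_entries:
  fixes M :: "real ^ 'n ^ 'n"
  assumes "invertible M"
  shows "(\<Sum>l\<in>UNIV. M $ i $ l * matrix_inv M $ l $ j) = (if i = j then 1 else 0)"
    and "(\<Sum>l\<in>UNIV. matrix_inv M $ i $ l * M $ l $ j) = (if i = j then 1 else 0)"
  using matrix_inv_mult[OF assms] by (auto simp: vec_eq_iff matrix_matrix_mult_def mat_def)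

lemma lower_raise:
  fixes M :: "real ^ 'n ^ 'n"
  assumes "invertible M"
  shows "(\<Sum>m\<in>UNIV. M $ k $ m * (\<Sum>l\<in>UNIV. matrix_inv M $ m $ l * h l)) = h k"
proof -
  have "(\<Sum>m\<in>UNIV. M $ k $ m * (\<Sum>l\<in>UNIV. matrix_inv M $ m $ l * h l)) =
      (\<Sum>m\<in>UNIV. \<Sum>l\<in>UNIV. M $ k $ m * matrix_inv M $ m $ l * h l)"
    by (simp add: sum_distrib_left mult_ac)
  also have "\<dots> = (\<Sum>l\<in>UNIV. \<Sum>m\<in>UNIV. M $ k $ m * matrix_inv M $ m $ l * h l)" by (rule sum.swap)
  also have "\<dots> = (\<Sum>l\<in>UNIV. (if k = l then 1 else 0) * h l)"
    by (simp add: sum_distrib_right[symmetric] matrix_inv_entries[OF assms])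
  also have "\<dots> = (\<Sum>l\<in>UNIV. (if k = l then h l else 0))" by (intro sum.cong) auto
  finally show ?thesis by simp
qed

lemma christoffel_lower:
  assumes "invertible (G x)"
  shows "(\<Sum>m\<in>UNIV. G x $ k $ m * christoffel G m i j x) =
    1/2 * (pderiv_at i (\<lambda>y. G y $ j $ k) x + pderiv_at j (\<lambda>y. G y $ i $ k) x
      - pderiv_at k (\<lambda>y. G y $ i $ j) x)"
  unfolding christoffel_def
  using lower_raise[OF assms, of k "\<lambda>l. pderiv_at i (\<lambda>y. G y $ j $ l) x + pderiv_at j (\<lambda>y. G y $ i $ l) x
      - pderiv_at l (\<lambda>y. G y $ i $ j) x"]
  by (simp add: mult.left_commute[of _ "1/2"] sum_distrib_left[symmetric] sum_divide_distrib[symmetric])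

text \<open>The covariant derivative of the metric vanishes.\<close>

lemma metric_compatible:
  assumes "invertible (G x)" and sym: "\<And>i j. G x $ i $ j = G x $ j $ i"
    and dsym: "\<And>k i j. pderiv_at k (\<lambda>y. G y $ i $ j) x = pderiv_at k (\<lambda>y. G y $ j $ i) x"
  shows "pderiv_at i (\<lambda>y. G y $ j $ k) x =
    (\<Sum>m\<in>UNIV. G x $ m $ k * christoffel G m i j x + G x $ j $ m * christoffel G m i k x)"
proof -
  have "(\<Sum>m\<in>UNIV. G x $ m $ k * christoffel G m i j x) = (\<Sum>m\<in>UNIV. G x $ k $ m * christoffel G m i j x)"
    by (intro sum.cong refl) (use sym in metis)
  then show ?thesis
    unfolding sum.distrib using christoffel_lower[of G x k i j, OF assms(1)] christoffel_lower[of G x j i k, OF assms(1)]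
      dsym[of k i j] dsym[of j i k] dsym[of i j k]
    by (simp add: field_simps)
qed

subsection \<open>The conformal change\<close>

text \<open>Two metrics \<open>G\<close> and \<open>G' = \<psi>\<^sup>-\<^sup>2 G\<close> in an open coordinate domain \<open>S\<close>.  Symmetry and the conformal
  relation are required on \<open>S\<close> only.\<close>

locale conformal_change =
  fixes S :: "(real ^ 'n) set" and G G' :: "real ^ 'n \<Rightarrow> real ^ 'n ^ 'n" and \<psi> :: "real ^ 'n \<Rightarrow> real"
  assumes S: "open S"
    and G_smooth: "smooth_on S (\<lambda>y. G y $ i $ j)"
    and G_inv: "y \<in> S \<Longrightarrow> invertible (G y)"
    and G_sym: "y \<in> S \<Longrightarrow> G y $ i $ j = G y $ j $ i"
    and psi_smooth: "smooth_on S \<psi>"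
    and psi_nz: "y \<in> S \<Longrightarrow> \<psi> y \<noteq> 0"
    and G': "y \<in> S \<Longrightarrow> G' y = inverse ((\<psi> y)\<^sup>2) *\<^sub>R G y"
begin

text \<open>The differential \<open>f\<close> of \<open>ln \<bar>\<psi>\<bar>\<close>, its gradient \<open>F\<close>, and the difference \<open>T\<close> of the Christoffel symbols
  of \<open>G'\<close> and \<open>G\<close>.\<close>

definition f where "f i y = pderiv_at i \<psi> y / \<psi> y"
definition F where "F k y = (\<Sum>l\<in>UNIV. matrix_inv (G y) $ k $ l * f l y)"
definition T where
  "T k i j y = - (if k = i then f j y else 0) - (if k = j then f i y else 0) + G y $ i $ j * F k y"

lemma f_smooth: "smooth_on S (f i)"
proof -
  have "smooth_on S (\<lambda>y. pderiv_at i \<psi> y / \<psi> y)"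
    using psi_smooth psi_nz by (intro smooth_on_divide smooth_on_pderiv S) auto
  then show ?thesis by (simp add: f_def[abs_def])
qed

lemma F_smooth: "smooth_on S (F k)"
proof -
  have "smooth_on S (\<lambda>y. \<Sum>l\<in>UNIV. matrix_inv (G y) $ k $ l * f l y)"
    by (intro smooth_on_sum smooth_on_mult smooth_on_matrix_inv f_smooth S G_smooth G_inv)
  then show ?thesis by (simp add: F_def[abs_def])
qed

lemma \<Gamma>_smooth: "smooth_on S (christoffel G k i j)"
  by (intro smooth_on_christoffel S G_smooth G_inv)

lemmas diffs = f_smooth[THEN smooth_on_differentiable] F_smooth[THEN smooth_on_differentiable]
  \<Gamma>_smooth[THEN smooth_on_differentiable] G_smooth[THEN smooth_on_differentiable]
  psi_smooth[THEN smooth_on_differentiable] psi_smooth[THEN smooth_on_pderiv, THEN smooth_on_differentiable]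

lemma G_dsym:
  assumes "x \<in> S"
  shows "pderiv_at k (\<lambda>y. G y $ i $ j) x = pderiv_at k (\<lambda>y. G y $ j $ i) x"
  by (rule pderiv_at_cong[OF S assms G_sym]) (use diffs assms in auto)

lemma pderiv_f:
  assumes "x \<in> S"
  shows "pderiv_at j (f k) x = pderiv_at j (pderiv_at k \<psi>) x / \<psi> x - f j x * f k x"
proof -
  have "pderiv_at j (f k) x = pderiv_at j (\<lambda>y. pderiv_at k \<psi> y * inverse (\<psi> y)) x"
    by (simp add: f_def[abs_def] divide_inverse)
  also have "\<dots> = pderiv_at j (pderiv_at k \<psi>) x / \<psi> x - f j x * f k x"
    using assms psi_nz[OF assms]
    by (subst pderiv_at_mult)
      (auto simp: diffs pderiv_at_inverse f_def power2_eq_square divide_inverse algebra_simps)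
  finally show ?thesis .
qed

lemma pderiv_G':
  assumes "x \<in> S"
  shows "pderiv_at i (\<lambda>y. G' y $ j $ l) x =
    inverse ((\<psi> x)\<^sup>2) * (pderiv_at i (\<lambda>y. G y $ j $ l) x - 2 * f i x * G x $ j $ l)"
proof -
  have nz: "\<psi> x \<noteq> 0" by (rule psi_nz[OF assms])
  have d2: "(\<lambda>y. (\<psi> y)\<^sup>2) differentiable (at x)" using diffs assms by simp
  have "pderiv_at i (\<lambda>y. G' y $ j $ l) x = pderiv_at i (\<lambda>y. inverse ((\<psi> y)\<^sup>2) * G y $ j $ l) x"
    by (rule pderiv_at_cong[OF S assms, symmetric]) (use G' diffs assms nz in auto)
  also have "\<dots> = inverse ((\<psi> x)\<^sup>2) * pderiv_at i (\<lambda>y. G y $ j $ l) x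
      + pderiv_at i (\<lambda>y. inverse ((\<psi> y)\<^sup>2)) x * G x $ j $ l"
    using diffs assms nz by (intro pderiv_at_mult) auto
  also have "pderiv_at i (\<lambda>y. inverse ((\<psi> y)\<^sup>2)) x = - (2 * \<psi> x * pderiv_at i \<psi> x) / ((\<psi> x)\<^sup>2)\<^sup>2"
    using pderiv_at_mult[of \<psi> x \<psi> i] diffs assms nz
    by (subst pderiv_at_inverse) (auto simp: power2_eq_square)
  also have "\<dots> = inverse ((\<psi> x)\<^sup>2) * (- 2 * f i x)"
    using nz by (simp add: f_def power2_eq_square divide_inverse)
  finally show ?thesis by (simp add: algebra_simps)
qed

lemma christoffel_G':
  assumes "x \<in> S"
  shows "christoffel G' k i j x = christoffel G k i j x + T k i j x"
proof -
  have nz: "\<psi> x \<noteq> 0" by (rule psi_nz[OF assms])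
  let ?H = "matrix_inv (G x)"
  have "matrix_inv (G' x) = (\<psi> x)\<^sup>2 *\<^sub>R ?H"
  proof (rule matrix_inv_unique_left)
    have "((\<psi> x)\<^sup>2 *\<^sub>R ?H) ** G' x = ((\<psi> x)\<^sup>2 * inverse ((\<psi> x)\<^sup>2)) *\<^sub>R (?H ** G x)"
      by (simp add: G'[OF assms] vec_eq_iff matrix_matrix_mult_def sum_distrib_left mult_ac)
    then show "((\<psi> x)\<^sup>2 *\<^sub>R ?H) ** G' x = mat 1"
      using nz matrix_inv_mult[OF G_inv[OF assms]] by simp
  qed
  then have inv: "matrix_inv (G' x) $ k $ l = (\<psi> x)\<^sup>2 * ?H $ k $ l" for l by simp
  have "christoffel G' k i j x = 1/2 * (\<Sum>l\<in>UNIV. ?H $ k $ l *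
       (pderiv_at i (\<lambda>y. G y $ j $ l) x + pderiv_at j (\<lambda>y. G y $ i $ l) x
        - pderiv_at l (\<lambda>y. G y $ i $ j) x
        - 2 * (f i x * G x $ l $ j + f j x * G x $ l $ i - f l x * G x $ i $ j)))"
    unfolding christoffel_def inv pderiv_G'[OF assms]
  proof (intro arg_cong[where f="\<lambda>z. 1/2 * z"] sum.cong refl)
    fix l
    have "(\<psi> x)\<^sup>2 * h * (inverse ((\<psi> x)\<^sup>2) * a + inverse ((\<psi> x)\<^sup>2) * b - inverse ((\<psi> x)\<^sup>2) * c) = h * (a + b - c)"
      for h a b c using nz by (simp add: field_simps)
    note e = this
    show "(\<psi> x)\<^sup>2 * ?H $ k $ l *
       (inverse ((\<psi> x)\<^sup>2) * (pderiv_at i (\<lambda>y. G y $ j $ l) x - 2 * f i x * G x $ j $ l)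
        + inverse ((\<psi> x)\<^sup>2) * (pderiv_at j (\<lambda>y. G y $ i $ l) x - 2 * f j x * G x $ i $ l)
        - inverse ((\<psi> x)\<^sup>2) * (pderiv_at l (\<lambda>y. G y $ i $ j) x - 2 * f l x * G x $ i $ j)) =
      ?H $ k $ l *
       (pderiv_at i (\<lambda>y. G y $ j $ l) x + pderiv_at j (\<lambda>y. G y $ i $ l) x
        - pderiv_at l (\<lambda>y. G y $ i $ j) x
        - 2 * (f i x * G x $ l $ j + f j x * G x $ l $ i - f l x * G x $ i $ j))"
      unfolding e G_sym[OF assms, of l i] G_sym[OF assms, of l j] by (simp add: algebra_simps)
  qed
  also have "\<dots> = christoffel G k i j x - (f i x * (\<Sum>l\<in>UNIV. ?H $ k $ l * G x $ l $ j)
      + f j x * (\<Sum>l\<in>UNIV. ?H $ k $ l * G x $ l $ i) - G x $ i $ j * (\<Sum>l\<in>UNIV. ?H $ k $ l * f l x))"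
    unfolding christoffel_def
    by (simp add: sum_distrib_left sum.distrib sum_subtractf right_diff_distrib distrib_left mult_ac)
  also have "\<dots> = christoffel G k i j x + T k i j x"
    unfolding matrix_inv_entries[OF G_inv[OF assms]] T_def F_def by simp
  finally show ?thesis .
qed

lemma pderiv_christoffel_G':
  assumes "x \<in> S"
  shows "pderiv_at a (christoffel G' k i j) x = pderiv_at a (christoffel G k i j) x + pderiv_at a (T k i j) x"
    and "pderiv_at a (T k i j) x = - (if k = i then pderiv_at a (f j) x else 0) - (if k = j then pderiv_at a (f i) x else 0)
      + (G x $ i $ j * pderiv_at a (F k) x + pderiv_at a (\<lambda>y. G y $ i $ j) x * F k x)"
    and "T k i j differentiable (at x)"
proof -
  note d = diffs[OF assms]
  have d1: "(\<lambda>y. - (if k = i then f j y else 0) - (if k = j then f i y else 0)) differentiable (at x)"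
    by (cases "k = i"; cases "k = j") (use d in auto)
  have d2: "(\<lambda>y. G y $ i $ j * F k y) differentiable (at x)" using d by auto
  have T: "T k i j = (\<lambda>y. - (if k = i then f j y else 0) - (if k = j then f i y else 0) + G y $ i $ j * F k y)"
    by (rule ext) (simp add: T_def)
  show dT: "T k i j differentiable (at x)" unfolding T using differentiable_add[OF d1 d2] .
  have n: "pderiv_at a (\<lambda>y. - f b y) x = - pderiv_at a (f b) x" for b
    using pderiv_at_cmult[OF d(1), of a "-1" b] by simp
  have n2: "pderiv_at a (\<lambda>y. - (2 * f b y)) x = - (2 * pderiv_at a (f b) x)" for b
    using pderiv_at_cmult[OF d(1), of a "-2" b] by simp
  have "pderiv_at a (\<lambda>y. - (if k = i then f j y else 0) - (if k = j then f i y else 0)) x =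
     - (if k = i then pderiv_at a (f j) x else 0) - (if k = j then pderiv_at a (f i) x else 0)"
    by (cases "k = i"; cases "k = j") (use d in \<open>auto simp: n n2 pderiv_at_diff\<close>)
  then show "pderiv_at a (T k i j) x = - (if k = i then pderiv_at a (f j) x else 0) - (if k = j then pderiv_at a (f i) x else 0)
      + (G x $ i $ j * pderiv_at a (F k) x + pderiv_at a (\<lambda>y. G y $ i $ j) x * F k x)"
    unfolding T using pderiv_at_add[OF d1 d2, of a] pderiv_at_mult[OF d(4) d(2), of a i j k] by simp
  have "pderiv_at a (christoffel G' k i j) x = pderiv_at a (\<lambda>y. christoffel G k i j y + T k i j y) x"
    by (rule pderiv_at_cong[OF S assms, symmetric]) (use christoffel_G' d dT in auto)
  then show "pderiv_at a (christoffel G' k i j) x = pderiv_at a (christoffel G k i j) x + pderiv_at a (T k i j) x"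
    using pderiv_at_add[OF d(3) dT] by simp
qed

text \<open>On a null vector the change of the Ricci tensor is a multiple of the Hessian of \<open>\<psi>\<close>.  No divergence
  of the gradient appears, because it is multiplied by the vanishing length of \<open>v\<close>.\<close>

lemma ricci_null_change:
  fixes v :: "real ^ 'n"
  assumes x: "x \<in> S" and null: "(\<Sum>i\<in>UNIV. \<Sum>j\<in>UNIV. v $ i * v $ j * G x $ i $ j) = 0"
  shows "(\<Sum>j\<in>UNIV. \<Sum>k\<in>UNIV. v $ j * v $ k * ricci G' x $ j $ k)
      - (\<Sum>j\<in>UNIV. \<Sum>k\<in>UNIV. v $ j * v $ k * ricci G x $ j $ k)
    = (real CARD('n) - 2) / \<psi> x * (\<Sum>j\<in>UNIV. \<Sum>k\<in>UNIV. v $ j * v $ k *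
        (pderiv_at j (pderiv_at k \<psi>) x - (\<Sum>m\<in>UNIV. christoffel G m j k x * pderiv_at m \<psi> x)))"
proof -
  let ?\<Gamma> = "\<lambda>k i j. christoffel G k i j x"
  let ?dG = "\<lambda>i j k. pderiv_at i (\<lambda>y. G y $ j $ k) x"
  interpret p: conformal_point ?\<Gamma> ?dG "\<lambda>i j. G x $ i $ j" "\<lambda>i. f i x" "\<lambda>k. F k x" "\<lambda>i. v $ i"
  proof
    show "(\<Sum>j\<in>UNIV. G x $ i $ j * F j x) = f i x" for i
      unfolding F_def by (rule lower_raise[OF G_inv[OF x]])
    show "?dG i j k = (\<Sum>m\<in>UNIV. G x $ m $ k * ?\<Gamma> m i j + G x $ j $ m * ?\<Gamma> m i k)" for i j k
      by (rule metric_compatible[of G x, OF G_inv[OF x] G_sym[OF x] G_dsym[OF x]])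
  qed (use christoffel_sym[of G x, OF G_dsym[OF x]] G_sym[OF x] null in auto)
  have pT: "p.T k i j = T k i j x" for k i j by (simp add: p.T_def T_def)
  have split: "(\<Sum>j\<in>UNIV. \<Sum>k\<in>UNIV. v $ j * v $ k * ricci H x $ j $ k) =
      (\<Sum>j\<in>UNIV. \<Sum>k\<in>UNIV. v $ j * v $ k * (\<Sum>i\<in>UNIV. pderiv_at i (christoffel H i j k) x
         - pderiv_at j (christoffel H i i k) x))
      + ricci_quad (\<lambda>k i j. christoffel H k i j x) (\<lambda>i. v $ i)" for H :: "real ^ 'n \<Rightarrow> real ^ 'n ^ 'n"
    unfolding ricci_def riemann_def ricci_quad_def
    by (simp add: sum.distrib distrib_left)
  have quad': "ricci_quad (\<lambda>k i j. christoffel G' k i j x) (\<lambda>i. v $ i) =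
      ricci_quad (\<lambda>k i j. ?\<Gamma> k i j + p.T k i j) (\<lambda>i. v $ i)"
    unfolding pT christoffel_G'[OF x] ..
  \<comment> \<open>The two derivative terms of the Ricci tensor: the divergence of \<open>T\<close> and the derivative of its trace.\<close>
  have divT: "(\<Sum>i\<in>UNIV. pderiv_at i (T i j k) x) = - pderiv_at j (f k) x - pderiv_at k (f j) x
     + G x $ j $ k * (\<Sum>i\<in>UNIV. pderiv_at i (F i) x) + (\<Sum>i\<in>UNIV. F i x * ?dG i j k)" for j k
  proof -
    have "(\<Sum>i\<in>UNIV. pderiv_at i (T i j k) x) = (\<Sum>i\<in>UNIV. (if i = j then - pderiv_at i (f k) x else 0))
      + (\<Sum>i\<in>UNIV. (if i = k then - pderiv_at i (f j) x else 0))
      + (\<Sum>i\<in>UNIV. G x $ j $ k * pderiv_at i (F i) x) + (\<Sum>i\<in>UNIV. F i x * ?dG i j k)"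
      unfolding pderiv_christoffel_G'(2)[OF x] sum.distrib[symmetric]
      by (intro sum.cong refl) auto
    also have "(\<Sum>i\<in>UNIV. (if i = j then - pderiv_at i (f k) x else 0)) = - pderiv_at j (f k) x" by simp
    also have "(\<Sum>i\<in>UNIV. (if i = k then - pderiv_at i (f j) x else 0)) = - pderiv_at k (f j) x" by simp
    finally show ?thesis by (simp add: sum_distrib_left)
  qed
  have trT: "(\<Sum>i\<in>UNIV. pderiv_at j (T i i k) x) = - real CARD('n) * pderiv_at j (f k) x" for j k
  proof -
    have "(\<Sum>i\<in>UNIV. pderiv_at j (T i i k) x) = pderiv_at j (\<lambda>y. \<Sum>i\<in>UNIV. T i i k y) x"
      by (rule pderiv_at_sum[symmetric]) (rule pderiv_christoffel_G'(3)[OF x])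
    also have "\<dots> = pderiv_at j (\<lambda>y. - real CARD('n) * f k y) x"
    proof (rule pderiv_at_cong[OF S x])
      fix y assume y: "y \<in> S"
      have "(\<Sum>i\<in>UNIV. T i i k y) = (\<Sum>i\<in>(UNIV::'n set). - f k y) + (\<Sum>i\<in>UNIV. (if i = k then - f i y else 0))
      + (\<Sum>i\<in>UNIV. G y $ k $ i * F i y)"
        unfolding T_def sum.distrib[symmetric] by (intro sum.cong refl) (auto simp: G_sym[OF y, of k])
      also have "(\<Sum>i\<in>UNIV. (if i = k then - f i y else 0)) = - f k y" by simp
      also have "(\<Sum>i\<in>UNIV. G y $ k $ i * F i y) = f k y"
        unfolding F_def by (rule lower_raise[OF G_inv[OF y]])
      finally show "(\<Sum>i\<in>UNIV. T i i k y) = - real CARD('n) * f k y" by simp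
    qed (use pderiv_christoffel_G'(3)[OF x] in auto)
    also have "\<dots> = - real CARD('n) * pderiv_at j (f k) x" by (rule pderiv_at_cmult[OF diffs(1)[OF x]])
    finally show ?thesis .
  qed
  have d: "(\<Sum>i\<in>UNIV. pderiv_at i (christoffel G' i j k) x - pderiv_at j (christoffel G' i i k) x)
     = (\<Sum>i\<in>UNIV. pderiv_at i (christoffel G i j k) x - pderiv_at j (christoffel G i i k) x)
       + (- pderiv_at j (f k) x - pderiv_at k (f j) x
     + G x $ j $ k * (\<Sum>i\<in>UNIV. pderiv_at i (F i) x) + (\<Sum>i\<in>UNIV. F i x * ?dG i j k)
     + real CARD('n) * pderiv_at j (f k) x)" for j k
    unfolding pderiv_christoffel_G'(1)[OF x] using divT[of j k] trT[of j k]
    by (simp add: sum.distrib sum_subtractf)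
  let ?D = "\<Sum>j\<in>UNIV. \<Sum>k\<in>UNIV. v $ j * v $ k * pderiv_at j (f k) x"
  have s1: "(\<Sum>j\<in>UNIV. \<Sum>k\<in>UNIV. v $ j * v $ k * pderiv_at k (f j) x) = ?D"
    by (subst sum.swap) (simp add: mult_ac)
  have s2: "(\<Sum>j\<in>UNIV. \<Sum>k\<in>UNIV. v $ j * v $ k * (G x $ j $ k * c)) = 0" for c
  proof -
    have "(\<Sum>j\<in>UNIV. \<Sum>k\<in>UNIV. v $ j * v $ k * (G x $ j $ k * c)) =
      (\<Sum>j\<in>UNIV. \<Sum>k\<in>UNIV. v $ j * v $ k * G x $ j $ k) * c"
      by (simp add: sum_distrib_right mult.assoc)
    then show ?thesis using null by simp
  qed
  have s3: "(\<Sum>j\<in>UNIV. \<Sum>k\<in>UNIV. v $ j * v $ k * (\<Sum>i\<in>UNIV. F i x * ?dG i j k)) =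
      (\<Sum>i\<in>UNIV. F i x * (\<Sum>j\<in>UNIV. \<Sum>k\<in>UNIV. v $ j * v $ k * ?dG i j k))"
  proof -
    have "(\<Sum>j\<in>UNIV. \<Sum>k\<in>UNIV. v $ j * v $ k * (\<Sum>i\<in>UNIV. F i x * ?dG i j k)) =
      (\<Sum>j\<in>UNIV. \<Sum>k\<in>UNIV. \<Sum>i\<in>UNIV. F i x * (v $ j * v $ k * ?dG i j k))"
      by (simp add: sum_distrib_left mult_ac)
    also have "\<dots> = (\<Sum>j\<in>UNIV. \<Sum>i\<in>UNIV. \<Sum>k\<in>UNIV. F i x * (v $ j * v $ k * ?dG i j k))"
      by (intro sum.cong refl sum.swap)
    also have "\<dots> = (\<Sum>i\<in>UNIV. \<Sum>j\<in>UNIV. \<Sum>k\<in>UNIV. F i x * (v $ j * v $ k * ?dG i j k))"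
      by (rule sum.swap)
    finally show ?thesis by (simp add: sum_distrib_left)
  qed
  have s4: "(\<Sum>j\<in>UNIV. \<Sum>k\<in>UNIV. v $ j * v $ k * (real CARD('n) * pderiv_at j (f k) x)) = real CARD('n) * ?D"
    by (simp add: sum_distrib_left mult_ac)
  have "(\<Sum>j\<in>UNIV. \<Sum>k\<in>UNIV. v $ j * v $ k * ricci G' x $ j $ k)
      - (\<Sum>j\<in>UNIV. \<Sum>k\<in>UNIV. v $ j * v $ k * ricci G x $ j $ k) =
     (real CARD('n) - 2) * ?D + (ricci_quad (\<lambda>k i j. ?\<Gamma> k i j + p.T k i j) (\<lambda>i. v $ i)
      - ricci_quad ?\<Gamma> (\<lambda>i. v $ i) +
      (\<Sum>i\<in>UNIV. F i x * (\<Sum>j\<in>UNIV. \<Sum>k\<in>UNIV. v $ j * v $ k * ?dG i j k)))"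
    unfolding split quad' d
    unfolding distrib_left right_diff_distrib sum.distrib sum_subtractf
      mult_minus_right sum_negf s1 s2 s3 s4
    by (simp add: algebra_simps)
  also have "\<dots> = (real CARD('n) - 2) * (?D + p.fv\<^sup>2 - (\<Sum>m\<in>UNIV. f m x * p.av m))"
    unfolding p.ricci_quad_change by (simp add: algebra_simps)
  also have "?D = (\<Sum>j\<in>UNIV. \<Sum>k\<in>UNIV. v $ j * v $ k * pderiv_at j (pderiv_at k \<psi>) x) / \<psi> x - p.fv\<^sup>2"
    unfolding pderiv_f[OF x] p.fv_def power2_eq_square sum_product
    by (simp add: sum_subtractf right_diff_distrib sum_divide_distrib mult_ac)
  also have "(\<Sum>m\<in>UNIV. f m x * p.av m) =
    (\<Sum>j\<in>UNIV. \<Sum>k\<in>UNIV. v $ j * v $ k * (\<Sum>m\<in>UNIV. ?\<Gamma> m j k * pderiv_at m \<psi> x)) / \<psi> x"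
  proof -
    have "(\<Sum>m\<in>UNIV. f m x * p.av m) = (\<Sum>m\<in>UNIV. \<Sum>j\<in>UNIV. \<Sum>k\<in>UNIV. v $ j * v $ k * (?\<Gamma> m j k * pderiv_at m \<psi> x) / \<psi> x)"
      by (simp add: p.av_def f_def sum_distrib_left mult_ac)
    also have "\<dots> = (\<Sum>j\<in>UNIV. \<Sum>m\<in>UNIV. \<Sum>k\<in>UNIV. v $ j * v $ k * (?\<Gamma> m j k * pderiv_at m \<psi> x) / \<psi> x)"
      by (rule sum.swap)
    also have "\<dots> = (\<Sum>j\<in>UNIV. \<Sum>k\<in>UNIV. \<Sum>m\<in>UNIV. v $ j * v $ k * (?\<Gamma> m j k * pderiv_at m \<psi> x) / \<psi> x)"
      by (intro sum.cong refl sum.swap)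
    finally show ?thesis by (simp add: sum_distrib_left sum_divide_distrib)
  qed
  finally show ?thesis
    unfolding right_diff_distrib[where a="v $ j * v $ k" for j k] sum_subtractf
    by (simp add: algebra_simps diff_divide_distrib)
qed

end

section \<open>Null directions of an indefinite form\<close>

text \<open>If \<open>b w w > 0\<close> and \<open>b z z < 0\<close>, then the line \<open>w + s z\<close> contains two null vectors, and these span the
  plane of \<open>w\<close> and \<open>z\<close>.\<close>

lemma null_directions_span:
  fixes b :: "'v::real_vector \<Rightarrow> 'v \<Rightarrow> real" and L :: "'v \<Rightarrow> real"
  assumes bl: "bilinear b" and sym: "\<And>u v. b u v = b v u" and L: "linear L"
    and pos: "b p p > 0" and neg: "b n n < 0"
    and null: "\<And>v. b v v = 0 \<Longrightarrow> L v = 0"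
  shows "L v = 0"
proof -
  have key: "L w = 0 \<and> L z = 0" if w: "b w w > 0" and z: "b z z < 0" for w z
  proof -
    define D where "D = (b w z)\<^sup>2 - b w w * b z z"
    have D: "D > 0" unfolding D_def using w z by (smt (verit) mult_pos_neg zero_le_power2)
    \<comment> \<open>For \<open>\<sigma> = 1\<close> and \<open>\<sigma> = -1\<close>, the roots \<open>s\<close> of \<open>b (w + s z) (w + s z)\<close>.\<close>
    define s where "s \<sigma> = (- b w z + \<sigma> * sqrt D) / b z z" for \<sigma>
    have "b (w + s \<sigma> *\<^sub>R z) (w + s \<sigma> *\<^sub>R z) = 0" if \<sigma>: "\<sigma>\<^sup>2 = 1" for \<sigma>
    proof -
      have "b (w + s \<sigma> *\<^sub>R z) (w + s \<sigma> *\<^sub>R z) = b w w + 2 * s \<sigma> * b w z + (s \<sigma>)\<^sup>2 * b z z"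
        using sym[of z w]
        by (simp add: bilinear_ladd[OF bl] bilinear_radd[OF bl] bilinear_lmul[OF bl] bilinear_rmul[OF bl]
            power2_eq_square algebra_simps)
      also have "b z z * \<dots> = b z z * b w w + 2 * (s \<sigma> * b z z) * b w z + (s \<sigma> * b z z)\<^sup>2"
        by (simp add: power2_eq_square algebra_simps)
      also have "s \<sigma> * b z z = - b w z + \<sigma> * sqrt D" using z by (simp add: s_def)
      also have "b z z * b w w + 2 * (- b w z + \<sigma> * sqrt D) * b w z + (- b w z + \<sigma> * sqrt D)\<^sup>2
          = b z z * b w w - (b w z)\<^sup>2 + \<sigma>\<^sup>2 * (sqrt D)\<^sup>2"
        by (simp add: power2_eq_square algebra_simps)
      also have "\<dots> = 0" using D \<sigma> by (simp add: D_def)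
      finally show ?thesis using z by simp
    qed
    then have e: "L w + s \<sigma> * L z = 0" if "\<sigma>\<^sup>2 = 1" for \<sigma>
      using null[of "w + s \<sigma> *\<^sub>R z"] that by (simp add: linear_add[OF L] linear_scale[OF L])
    have e1: "L w + s 1 * L z = 0" and e2: "L w + s (-1) * L z = 0"
      using e[of 1] e[of "-1"] by simp_all
    have "s 1 - s (-1) = 2 * sqrt D / b z z" by (simp add: s_def diff_divide_distrib[symmetric])
    then have "s 1 - s (-1) \<noteq> 0" using D z by simp
    moreover have "(s 1 - s (-1)) * L z = (L w + s 1 * L z) - (L w + s (-1) * L z)"
      by (simp add: algebra_simps)
    then have "(s 1 - s (-1)) * L z = 0" unfolding e1 e2 by simp
    ultimately show ?thesis using e1 by simp
  qed
  show ?thesis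
    using key[OF pos, of v] key[OF _ neg, of v] null[of v] by linarith
qed

section \<open>Geodesics in a coordinate domain\<close>

subsection \<open>Existence\<close>

lemma smooth_lipschitz:
  fixes h :: "real ^ 'n \<Rightarrow> real"
  assumes h: "smooth_on S h" and K: "compact K" "convex K" "K \<subseteq> S"
  shows "\<exists>L. L-lipschitz_on K h"
proof -
  have "\<exists>B. \<forall>y\<in>K. norm (pderiv_at i h y) \<le> B" for i
  proof -
    have "continuous_on K (pderiv_at i h)"
      using smooth_on_continuous_on[OF smooth_on_pderiv[OF h]] K(3) continuous_on_subset by blast
    then have "bounded (pderiv_at i h ` K)" using K(1) compact_continuous_image compact_imp_bounded by blast
    then show ?thesis by (auto simp: bounded_iff)
  qed
  then obtain B where B: "\<And>i y. y \<in> K \<Longrightarrow> norm (pderiv_at i h y) \<le> B i" by metis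
  let ?M = "\<Sum>i\<in>UNIV. \<bar>B i\<bar>"
  have "norm (h y - h z) \<le> ?M * norm (y - z)" if "y \<in> K" "z \<in> K" for y z
  proof (rule differentiable_bound[OF K(2) _ _ that])
    fix u assume u: "u \<in> K"
    have d: "h differentiable (at u)" using h K u smooth_on_differentiable by blast
    show "(h has_derivative frechet_derivative h (at u)) (at u within K)"
      using d frechet_derivative_works has_derivative_at_withinI by blast
    show "onorm (frechet_derivative h (at u)) \<le> ?M"
    proof (rule onorm_le)
      fix w :: "real ^ 'n"
      have "norm (frechet_derivative h (at u) w) \<le> (\<Sum>i\<in>UNIV. norm (w $ i * pderiv_at i h u))"
        unfolding frechet_pderiv[OF d] by (rule norm_sum)
      also have "\<dots> \<le> (\<Sum>i\<in>UNIV. norm w * \<bar>B i\<bar>)"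
        using B[OF u] by (intro sum_mono) (auto simp: abs_mult intro!: mult_mono component_le_norm_cart order_trans[OF B[OF u, unfolded real_norm_def]])
      finally show "norm (frechet_derivative h (at u) w) \<le> ?M * norm w"
        by (simp add: sum_distrib_left mult.commute)
    qed
  qed
  then show ?thesis
    by (intro exI[of _ ?M] lipschitz_onI) (auto simp: dist_norm intro: sum_nonneg)
qed

lemma lipschitz_mult_compact:
  fixes f g :: "'a::metric_space \<Rightarrow> real"
  assumes "compact K" "\<exists>L. L-lipschitz_on K f" "\<exists>L. L-lipschitz_on K g"
  shows "\<exists>L. L-lipschitz_on K (\<lambda>x. f x * g x)"
proof -
  obtain L M where L: "L-lipschitz_on K f" and M: "M-lipschitz_on K g" using assms by blast
  have "bounded (f ` K)" "bounded (g ` K)"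
    using assms(1) lipschitz_on_continuous_on[OF L] lipschitz_on_continuous_on[OF M]
      compact_continuous_image compact_imp_bounded by blast+
  then obtain a b where "\<And>x. x \<in> K \<Longrightarrow> \<bar>f x\<bar> \<le> a" "\<And>x. x \<in> K \<Longrightarrow> \<bar>g x\<bar> \<le> b"
    by (auto simp: bounded_iff)
  then have ab: "\<And>x. x \<in> K \<Longrightarrow> \<bar>f x\<bar> \<le> \<bar>a\<bar>" "\<And>x. x \<in> K \<Longrightarrow> \<bar>g x\<bar> \<le> \<bar>b\<bar>"
    by (meson abs_ge_self order_trans)+
  have nn: "L \<ge> 0" "M \<ge> 0" using L M lipschitz_on_nonneg by auto
  have "(\<bar>a\<bar> * M + L * \<bar>b\<bar>)-lipschitz_on K (\<lambda>x. f x * g x)"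
  proof (rule lipschitz_onI)
    fix x y assume xy: "x \<in> K" "y \<in> K"
    have "\<bar>f x * g x - f y * g y\<bar> = \<bar>f x * (g x - g y) + (f x - f y) * g y\<bar>" by (simp add: algebra_simps)
    also have "\<dots> \<le> \<bar>f x\<bar> * \<bar>g x - g y\<bar> + \<bar>f x - f y\<bar> * \<bar>g y\<bar>"
      by (metis abs_mult abs_triangle_ineq)
    also have "\<dots> \<le> \<bar>a\<bar> * (M * dist x y) + (L * dist x y) * \<bar>b\<bar>"
      using xy ab lipschitz_onD[OF L xy] lipschitz_onD[OF M xy] nn
      by (intro add_mono mult_mono) (auto simp: dist_real_def)
    finally show "dist (f x * g x) (f y * g y) \<le> (\<bar>a\<bar> * M + L * \<bar>b\<bar>) * dist x y"
      by (simp add: dist_real_def algebra_simps)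
  qed (use nn in auto)
  then show ?thesis by blast
qed

lemma lipschitz_sum:
  fixes f :: "'i \<Rightarrow> 'a::metric_space \<Rightarrow> real"
  assumes "\<And>i. i \<in> I \<Longrightarrow> \<exists>L. L-lipschitz_on K (f i)"
  shows "\<exists>L. L-lipschitz_on K (\<lambda>x. \<Sum>i\<in>I. f i x)"
  using assms
proof (induction I rule: infinite_finite_induct)
  case (insert a I)
  then obtain L M where "L-lipschitz_on K (f a)" "M-lipschitz_on K (\<lambda>x. \<Sum>i\<in>I. f i x)" by blast
  then have "(L + M)-lipschitz_on K (\<lambda>x. f a x + (\<Sum>i\<in>I. f i x))" by (rule lipschitz_on_add)
  then show ?case using insert by auto
qed (auto intro: exI[of _ 0] lipschitz_on_constant)

text \<open>The geodesic equation as a first-order system for the pair of position and velocity.  Its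
  right-hand side is Lipschitz near the initial pair, being built from smooth functions by sums and
  products.\<close>

lemma geodesic_exists_local:
  fixes \<Gamma> :: "'n::finite \<Rightarrow> 'n \<Rightarrow> 'n \<Rightarrow> real ^ 'n \<Rightarrow> real"
  assumes S: "open S" and \<Gamma>: "\<And>k i j. smooth_on S (\<Gamma> k i j)" and x0: "x0 \<in> S"
  obtains \<epsilon> and x x' :: "real \<Rightarrow> real ^ 'n" where "\<epsilon> > 0" "x 0 = x0" "x' 0 = v"
    "\<forall>t\<in>{-\<epsilon><..<\<epsilon>}. x t \<in> S"
    "\<forall>t\<in>{-\<epsilon><..<\<epsilon>}. (x has_vector_derivative x' t) (at t)"
    "\<forall>t\<in>{-\<epsilon><..<\<epsilon>}. (x' has_vector_derivative
        (\<chi> k. - (\<Sum>i\<in>UNIV. \<Sum>j\<in>UNIV. \<Gamma> k i j (x t) * x' t $ i * x' t $ j))) (at t)"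
proof -
  obtain r where r: "r > 0" "cball x0 r \<subseteq> S" using S x0 open_contains_cball by blast
  let ?K = "cball (x0, v) r"
  define \<Phi> :: "'n \<Rightarrow> (real ^ 'n) \<times> (real ^ 'n) \<Rightarrow> real"
    where "\<Phi> k y = (\<Sum>i\<in>UNIV. \<Sum>j\<in>UNIV. \<Gamma> k i j (fst y) * snd y $ i * snd y $ j)" for k y
  define F where "F y = (snd y, \<chi> k. - \<Phi> k y)" for y
  have Kc: "compact ?K" by simp
  have fstK: "fst y \<in> cball x0 r" if "y \<in> ?K" for y
    using that dist_fst_le[of "(x0, v)" y] by auto
  have "\<exists>L. L-lipschitz_on ?K (\<Phi> k)" for k
    unfolding \<Phi>_def[abs_def]
  proof (intro lipschitz_sum lipschitz_mult_compact Kc)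
    fix i j
    obtain L where L: "L-lipschitz_on (cball x0 r) (\<Gamma> k i j)"
      using smooth_lipschitz[OF \<Gamma> compact_cball convex_cball r(2)] by blast
    have "L-lipschitz_on ?K (\<lambda>y. \<Gamma> k i j (fst y))"
    proof (rule lipschitz_onI)
      fix y z assume yz: "y \<in> ?K" "z \<in> ?K"
      have "dist (\<Gamma> k i j (fst y)) (\<Gamma> k i j (fst z)) \<le> L * dist (fst y) (fst z)"
        by (rule lipschitz_onD[OF L fstK[OF yz(1)] fstK[OF yz(2)]])
      also have "\<dots> \<le> L * dist y z"
        using lipschitz_on_nonneg[OF L] dist_fst_le mult_left_mono by blast
      finally show "dist (\<Gamma> k i j (fst y)) (\<Gamma> k i j (fst z)) \<le> L * dist y z" .
    qed (rule lipschitz_on_nonneg[OF L])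
    then show "\<exists>L. L-lipschitz_on ?K (\<lambda>y. \<Gamma> k i j (fst y))" by blast
    have "1-lipschitz_on ?K (\<lambda>y. snd y $ i)" for i
      by (rule lipschitz_onI) (auto intro: order_trans[OF dist_vec_nth_le dist_snd_le])
    then show "\<exists>L. L-lipschitz_on ?K (\<lambda>y. snd y $ i)" "\<exists>L. L-lipschitz_on ?K (\<lambda>y. snd y $ j)" by blast+
  qed
  then obtain L where L: "\<And>k. (L k)-lipschitz_on ?K (\<Phi> k)" by metis
  have "norm (F y - F z) \<le> (1 + (\<Sum>k\<in>UNIV. L k)) * norm (y - z)" if yz: "y \<in> ?K" "z \<in> ?K" for y z
  proof -
    have "norm (F y - F z) \<le> norm (fst (F y - F z)) + norm (snd (F y - F z))"
      by (metis norm_Pair_le prod.collapse)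
    also have "norm (fst (F y - F z)) \<le> norm (y - z)"
      using dist_snd_le[of y z] by (simp add: F_def dist_norm)
    also have "norm (snd (F y - F z)) \<le> (\<Sum>k\<in>UNIV. \<bar>snd (F y - F z) $ k\<bar>)"
      by (rule norm_le_l1_cart)
    also have "\<dots> \<le> (\<Sum>k\<in>UNIV. L k * norm (y - z))"
    proof (rule sum_mono)
      fix k
      show "\<bar>snd (F y - F z) $ k\<bar> \<le> L k * norm (y - z)"
        using lipschitz_onD[OF L yz, of k] by (simp add: F_def dist_norm abs_minus_commute)
    qed
    finally show ?thesis by (simp add: algebra_simps sum_distrib_right)
  qed
  then obtain \<epsilon> u where u: "\<epsilon> > 0" "u 0 = (x0, v)"
    "\<And>t. t \<in> {-\<epsilon><..<\<epsilon>} \<Longrightarrow> u t \<in> ?K"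
    "\<And>t. t \<in> {-\<epsilon><..<\<epsilon>} \<Longrightarrow> (u has_vector_derivative F (u t)) (at t)"
    using picard_local[OF r(1), of "(x0, v)" F] by blast
  show ?thesis
  proof (rule that[of \<epsilon> "\<lambda>t. fst (u t)" "\<lambda>t. snd (u t)"])
    show "\<forall>t\<in>{-\<epsilon><..<\<epsilon>}. fst (u t) \<in> S" using fstK u(3) r by blast
    show "\<forall>t\<in>{-\<epsilon><..<\<epsilon>}. ((\<lambda>t. fst (u t)) has_vector_derivative snd (u t)) (at t)"
      using bounded_linear.has_vector_derivative[OF bounded_linear_fst u(4)] by (simp add: F_def)
    show "\<forall>t\<in>{-\<epsilon><..<\<epsilon>}. ((\<lambda>t. snd (u t)) has_vector_derivative
        (\<chi> k. - (\<Sum>i\<in>UNIV. \<Sum>j\<in>UNIV. \<Gamma> k i j (fst (u t)) * snd (u t) $ i * snd (u t) $ j))) (at t)"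
      using bounded_linear.has_vector_derivative[OF bounded_linear_snd u(4)] by (simp add: F_def \<Phi>_def)
  qed (use u in auto)
qed

subsection \<open>Functions along geodesics\<close>

lemma has_real_derivative_along:
  fixes f :: "real ^ 'n \<Rightarrow> real"
  assumes "f differentiable (at (x t))" "(x has_vector_derivative p) (at t)"
  shows "((\<lambda>s. f (x s)) has_real_derivative (\<Sum>i\<in>UNIV. p $ i * pderiv_at i f (x t))) (at t)"
proof -
  have "((\<lambda>s. f (x s)) has_derivative (\<lambda>h. frechet_derivative f (at (x t)) (h *\<^sub>R p))) (at t)"
    using has_derivative_compose[of x "\<lambda>h. h *\<^sub>R p" t UNIV f] assms
    unfolding has_vector_derivative_def frechet_derivative_works by simp
  then show ?thesis
    unfolding has_field_derivative_def
    by (rule has_derivative_eq_rhs)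
      (auto simp: fun_eq_iff frechet_pderiv[OF assms(1)] sum_distrib_right intro!: sum.cong)
qed

lemma has_real_derivative_nth:
  "(x has_vector_derivative p) (at t) \<Longrightarrow> ((\<lambda>s. x s $ i) has_real_derivative p $ i) (at t)"
  unfolding has_real_derivative_iff_has_vector_derivative
  by (rule bounded_linear.has_vector_derivative[OF bounded_linear_vec_nth])

text \<open>By metric compatibility the length of the velocity is stationary along a solution of the geodesic
  equation.\<close>

lemma energy_derivative_zero:
  fixes G :: "real ^ 'n \<Rightarrow> real ^ 'n ^ 'n"
  assumes sm: "\<And>i j. (\<lambda>y. G y $ i $ j) differentiable (at (x t))"
    and inv: "invertible (G (x t))"
    and sym: "\<And>i j. G (x t) $ i $ j = G (x t) $ j $ i"
    and dsym: "\<And>k i j. pderiv_at k (\<lambda>y. G y $ i $ j) (x t) = pderiv_at k (\<lambda>y. G y $ j $ i) (x t)"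
    and x: "(x has_vector_derivative x' t) (at t)"
    and x': "(x' has_vector_derivative
        (\<chi> k. - (\<Sum>i\<in>UNIV. \<Sum>j\<in>UNIV. christoffel G k i j (x t) * x' t $ i * x' t $ j))) (at t)"
  shows "((\<lambda>s. \<Sum>i\<in>UNIV. \<Sum>j\<in>UNIV. x' s $ i * x' s $ j * G (x s) $ i $ j) has_real_derivative 0) (at t)"
proof -
  let ?p = "x' t"
  define q where "q m = (\<Sum>i\<in>UNIV. \<Sum>j\<in>UNIV. ?p $ i * ?p $ j * christoffel G m i j (x t))" for m
  let ?G = "\<lambda>i j. G (x t) $ i $ j"
  let ?dG = "\<lambda>i j. \<Sum>k\<in>UNIV. ?p $ k * pderiv_at k (\<lambda>y. G y $ i $ j) (x t)"
  have dp: "((\<lambda>s. x' s $ i) has_real_derivative - q i) (at t)" for i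
    using has_real_derivative_nth[OF x', of i] by (simp add: q_def mult_ac)
  have dG: "((\<lambda>s. G (x s) $ i $ j) has_real_derivative ?dG i j) (at t)" for i j
    by (rule has_real_derivative_along[OF sm x])
  have e: "((\<lambda>s. \<Sum>i\<in>UNIV. \<Sum>j\<in>UNIV. x' s $ i * x' s $ j * G (x s) $ i $ j) has_real_derivative
     (\<Sum>i\<in>UNIV. \<Sum>j\<in>UNIV. (- q i * ?p $ j + - q j * ?p $ i) * ?G i j + ?dG i j * (?p $ i * ?p $ j))) (at t)"
    by (intro DERIV_sum DERIV_mult dp dG)
  have P: "(\<Sum>i\<in>UNIV. \<Sum>j\<in>UNIV. ?dG i j * (?p $ i * ?p $ j)) =
     (\<Sum>i\<in>UNIV. \<Sum>j\<in>UNIV. q i * ?p $ j * ?G i j) + (\<Sum>i\<in>UNIV. \<Sum>j\<in>UNIV. q j * ?p $ i * ?G i j)"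
  proof -
    let ?t1 = "\<lambda>i j k m. ?p $ k * ?p $ i * ?p $ j * (?G m j * christoffel G m k i (x t))"
    let ?t2 = "\<lambda>i j k m. ?p $ k * ?p $ i * ?p $ j * (?G i m * christoffel G m k j (x t))"
    have "(\<Sum>i\<in>UNIV. \<Sum>j\<in>UNIV. ?dG i j * (?p $ i * ?p $ j)) =
      (\<Sum>i\<in>UNIV. \<Sum>j\<in>UNIV. \<Sum>k\<in>UNIV. \<Sum>m\<in>UNIV. ?t1 i j k m) + (\<Sum>i\<in>UNIV. \<Sum>j\<in>UNIV. \<Sum>k\<in>UNIV. \<Sum>m\<in>UNIV. ?t2 i j k m)"
      unfolding metric_compatible[of G "x t", OF inv sym dsym] sum.distrib[symmetric]
      by (simp add: sum_distrib_left sum_distrib_right algebra_simps)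
    also have "(\<Sum>i\<in>UNIV. \<Sum>j\<in>UNIV. \<Sum>k\<in>UNIV. \<Sum>m\<in>UNIV. ?t1 i j k m) = (\<Sum>i\<in>UNIV. \<Sum>j\<in>UNIV. q i * ?p $ j * ?G i j)"
    proof -
      have "(\<Sum>i\<in>UNIV. \<Sum>j\<in>UNIV. \<Sum>k\<in>UNIV. \<Sum>m\<in>UNIV. ?t1 i j k m) = (\<Sum>j\<in>UNIV. \<Sum>i\<in>UNIV. \<Sum>m\<in>UNIV. \<Sum>k\<in>UNIV. ?t1 i j k m)"
        by (subst sum.swap) (intro sum.cong refl sum.swap)
      also have "\<dots> = (\<Sum>j\<in>UNIV. \<Sum>m\<in>UNIV. \<Sum>i\<in>UNIV. \<Sum>k\<in>UNIV. ?t1 i j k m)"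
        by (intro sum.cong refl sum.swap)
      also have "\<dots> = (\<Sum>m\<in>UNIV. \<Sum>j\<in>UNIV. \<Sum>k\<in>UNIV. \<Sum>i\<in>UNIV. ?t1 i j k m)"
        by (subst sum.swap) (intro sum.cong refl sum.swap)
      finally show ?thesis by (simp add: q_def sum_distrib_left sum_distrib_right mult_ac)
    qed
    also have "(\<Sum>i\<in>UNIV. \<Sum>j\<in>UNIV. \<Sum>k\<in>UNIV. \<Sum>m\<in>UNIV. ?t2 i j k m) = (\<Sum>i\<in>UNIV. \<Sum>j\<in>UNIV. q j * ?p $ i * ?G i j)"
    proof -
      have "(\<Sum>i\<in>UNIV. \<Sum>j\<in>UNIV. \<Sum>k\<in>UNIV. \<Sum>m\<in>UNIV. ?t2 i j k m) = (\<Sum>i\<in>UNIV. \<Sum>j\<in>UNIV. \<Sum>m\<in>UNIV. \<Sum>k\<in>UNIV. ?t2 i j k m)"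
        by (intro sum.cong refl sum.swap)
      also have "\<dots> = (\<Sum>i\<in>UNIV. \<Sum>m\<in>UNIV. \<Sum>j\<in>UNIV. \<Sum>k\<in>UNIV. ?t2 i j k m)"
        by (intro sum.cong refl sum.swap)
      also have "\<dots> = (\<Sum>i\<in>UNIV. \<Sum>m\<in>UNIV. \<Sum>k\<in>UNIV. \<Sum>j\<in>UNIV. ?t2 i j k m)"
        by (intro sum.cong refl sum.swap)
      finally show ?thesis by (simp add: q_def sum_distrib_left sum_distrib_right mult_ac)
    qed
    finally show ?thesis .
  qed
  have "(\<Sum>i\<in>UNIV. \<Sum>j\<in>UNIV. (- q i * ?p $ j + - q j * ?p $ i) * ?G i j + ?dG i j * (?p $ i * ?p $ j)) = 0"
    unfolding sum.distrib P by (simp add: sum.distrib sum_subtractf sum_negf algebra_simps)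
  then show ?thesis using e by simp
qed

text \<open>The derivative of \<open>d\<psi>(x')\<close> along a geodesic is the Hessian of \<open>\<psi>\<close> on the velocity.\<close>

lemma second_derivative_along_geodesic:
  fixes G :: "real ^ 'n \<Rightarrow> real ^ 'n ^ 'n" and \<psi> :: "real ^ 'n \<Rightarrow> real"
  assumes d2: "\<And>i. pderiv_at i \<psi> differentiable (at (x t))"
    and x: "(x has_vector_derivative x' t) (at t)"
    and x': "(x' has_vector_derivative
        (\<chi> k. - (\<Sum>i\<in>UNIV. \<Sum>j\<in>UNIV. christoffel G k i j (x t) * x' t $ i * x' t $ j))) (at t)"
  shows "((\<lambda>s. \<Sum>i\<in>UNIV. x' s $ i * pderiv_at i \<psi> (x s)) has_real_derivative
    (\<Sum>j\<in>UNIV. \<Sum>k\<in>UNIV. x' t $ j * x' t $ k *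
        (pderiv_at j (pderiv_at k \<psi>) (x t) - (\<Sum>m\<in>UNIV. christoffel G m j k (x t) * pderiv_at m \<psi> (x t))))) (at t)"
proof -
  let ?p = "x' t"
  define q where "q m = (\<Sum>i\<in>UNIV. \<Sum>j\<in>UNIV. ?p $ i * ?p $ j * christoffel G m i j (x t))" for m
  have dp: "((\<lambda>s. x' s $ i) has_real_derivative - q i) (at t)" for i
    using has_real_derivative_nth[OF x', of i] by (simp add: q_def mult_ac)
  have e: "((\<lambda>s. \<Sum>i\<in>UNIV. x' s $ i * pderiv_at i \<psi> (x s)) has_real_derivative
     (\<Sum>i\<in>UNIV. - q i * pderiv_at i \<psi> (x t) + (\<Sum>j\<in>UNIV. ?p $ j * pderiv_at j (pderiv_at i \<psi>) (x t)) * ?p $ i)) (at t)"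
    by (intro DERIV_sum DERIV_mult dp has_real_derivative_along[OF d2 x])
  have h: "(\<Sum>i\<in>UNIV. (\<Sum>j\<in>UNIV. ?p $ j * pderiv_at j (pderiv_at i \<psi>) (x t)) * ?p $ i) =
      (\<Sum>j\<in>UNIV. \<Sum>k\<in>UNIV. ?p $ j * ?p $ k * pderiv_at j (pderiv_at k \<psi>) (x t))"
    unfolding sum_distrib_right by (subst sum.swap) (simp add: mult_ac)
  have q: "(\<Sum>i\<in>UNIV. q i * pderiv_at i \<psi> (x t)) =
      (\<Sum>j\<in>UNIV. \<Sum>k\<in>UNIV. ?p $ j * ?p $ k * (\<Sum>m\<in>UNIV. christoffel G m j k (x t) * pderiv_at m \<psi> (x t)))"
  proof -
    have "(\<Sum>i\<in>UNIV. q i * pderiv_at i \<psi> (x t)) = (\<Sum>m\<in>UNIV. \<Sum>j\<in>UNIV. \<Sum>k\<in>UNIV.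
        ?p $ j * ?p $ k * (christoffel G m j k (x t) * pderiv_at m \<psi> (x t)))"
      by (simp add: q_def sum_distrib_right mult.assoc)
    also have "\<dots> = (\<Sum>j\<in>UNIV. \<Sum>m\<in>UNIV. \<Sum>k\<in>UNIV.
        ?p $ j * ?p $ k * (christoffel G m j k (x t) * pderiv_at m \<psi> (x t)))"
      by (rule sum.swap)
    also have "\<dots> = (\<Sum>j\<in>UNIV. \<Sum>k\<in>UNIV. \<Sum>m\<in>UNIV.
        ?p $ j * ?p $ k * (christoffel G m j k (x t) * pderiv_at m \<psi> (x t)))"
      by (intro sum.cong refl sum.swap)
    finally show ?thesis by (simp add: sum_distrib_left)
  qed
  have "(\<Sum>i\<in>UNIV. - q i * pderiv_at i \<psi> (x t) + (\<Sum>j\<in>UNIV. ?p $ j * pderiv_at j (pderiv_at i \<psi>) (x t)) * ?p $ i) =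
    (\<Sum>j\<in>UNIV. \<Sum>k\<in>UNIV. ?p $ j * ?p $ k *
        (pderiv_at j (pderiv_at k \<psi>) (x t) - (\<Sum>m\<in>UNIV. christoffel G m j k (x t) * pderiv_at m \<psi> (x t))))"
    unfolding sum.distrib h using q by (simp add: sum_negf right_diff_distrib sum_subtractf)
  then show ?thesis using e by simp
qed

section \<open>Charts and tangent vectors\<close>

locale smooth_mfd =
  fixes X :: "'a topology" and A :: "('a, 'n::finite) chart set"
  assumes mfd: "smooth_manifold X A"
begin

lemma chart: "c \<in> A \<Longrightarrow> is_chart X c"
  using mfd unfolding smooth_manifold_def by blast

lemma covered: "p \<in> topspace X \<Longrightarrow> \<exists>c\<in>A. p \<in> fst c"
  using mfd unfolding smooth_manifold_def by blast

lemma chart_subset: "c \<in> A \<Longrightarrow> p \<in> fst c \<Longrightarrow> p \<in> topspace X"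
  using chart openin_subset unfolding is_chart_def by blast

lemma chart_open: "c \<in> A \<Longrightarrow> open (snd c ` fst c)"
  using chart unfolding is_chart_def by blast

lemma chart_homeo: "c \<in> A \<Longrightarrow> homeomorphic_map (subtopology X (fst c)) (top_of_set (snd c ` fst c)) (snd c)"
  using chart unfolding is_chart_def by blast

lemma chart_topspace: "c \<in> A \<Longrightarrow> topspace (subtopology X (fst c)) = fst c"
  using chart_subset[of c] by (auto simp: topspace_subtopology)

lemma chart_inj: "c \<in> A \<Longrightarrow> inj_on (snd c) (fst c)"
  using homeomorphic_imp_injective_map[OF chart_homeo] chart_topspace by metis

lemma chart_inv_left: "c \<in> A \<Longrightarrow> p \<in> fst c \<Longrightarrow> chart_inv c (snd c p) = p"
  unfolding chart_inv_def by (rule inv_into_f_f[OF chart_inj])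

lemma chart_inv_right: "x \<in> snd c ` fst c \<Longrightarrow> snd c (chart_inv c x) = x"
  unfolding chart_inv_def by (rule f_inv_into_f)

lemma chart_inv_in: "x \<in> snd c ` fst c \<Longrightarrow> chart_inv c x \<in> fst c"
  unfolding chart_inv_def by (rule inv_into_into)

lemma open_chart_image:
  assumes c: "c \<in> A" and U: "openin X U" "U \<subseteq> fst c"
  shows "open (snd c ` U)"
proof -
  have "openin (subtopology X (fst c)) U" using U openin_subset_topspace_eq
    by (metis inf.absorb_iff1 openin_subtopology)
  then have "openin (top_of_set (snd c ` fst c)) (snd c ` U)"
    using homeomorphic_map_openness[OF chart_homeo[OF c]] U(2) chart_topspace[OF c] by metis
  then show ?thesis using openin_open_trans chart_open[OF c] by blast
qed

text \<open>Openness of a subset of the manifold can be tested in the charts.\<close>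

lemma openin_chartI:
  assumes op: "\<And>c. c \<in> A \<Longrightarrow> open {x \<in> snd c ` fst c. P (chart_inv c x)}"
  shows "openin X {p \<in> topspace X. P p}"
proof -
  have "openin X {p \<in> fst c. P p}" if c: "c \<in> A" for c
  proof -
    have e: "snd c ` {p \<in> fst c. P p} = {x \<in> snd c ` fst c. P (chart_inv c x)}"
      using chart_inv_left[OF c] by auto
    have "openin (top_of_set (snd c ` fst c)) (snd c ` {p \<in> fst c. P p})"
      unfolding e using op[OF c] by (intro open_subset) auto
    then have "openin (subtopology X (fst c)) {p \<in> fst c. P p}"
      using homeomorphic_map_openness[OF chart_homeo[OF c], of "{p \<in> fst c. P p}"] chart_topspace[OF c]
      by auto
    then show ?thesis
      using chart[OF c] openin_trans_full unfolding is_chart_def by blast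
  qed
  then have "openin X (\<Union>c\<in>A. {p \<in> fst c. P p})" by blast
  moreover have "(\<Union>c\<in>A. {p \<in> fst c. P p}) = {p \<in> topspace X. P p}"
    using covered chart_subset by blast
  ultimately show ?thesis by simp
qed

text \<open>Connectedness: a property that is open together with its negation, as tested in charts, holds
  everywhere if it holds at one point.\<close>

lemma connected_constant_property:
  assumes "connected_space X" "p \<in> topspace X" "P p"
    and "\<And>c. c \<in> A \<Longrightarrow> open {x \<in> snd c ` fst c. P (chart_inv c x)}"
    and "\<And>c. c \<in> A \<Longrightarrow> open {x \<in> snd c ` fst c. \<not> P (chart_inv c x)}"
    and "q \<in> topspace X"
  shows "P q"
proof -
  let ?U = "{p \<in> topspace X. P p}"
  have "openin X ?U" by (rule openin_chartI[OF assms(4)])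
  moreover have "closedin X ?U"
  proof -
    have "openin X {p \<in> topspace X. \<not> P p}" by (rule openin_chartI[OF assms(5)])
    moreover have "topspace X - ?U = {p \<in> topspace X. \<not> P p}" by blast
    ultimately show ?thesis by (simp add: closedin_def)
  qed
  ultimately have "?U = {} \<or> ?U = topspace X"
    using assms(1) connected_space_clopen_in by blast
  then show ?thesis using assms(2,3,6) by blast
qed

lemma overlap_open: "c \<in> A \<Longrightarrow> d \<in> A \<Longrightarrow> open (snd c ` (fst c \<inter> fst d))"
  using chart[of c] chart[of d] unfolding is_chart_def by (intro open_chart_image openin_Int) auto

lemma transition_differentiable:
  "c \<in> A \<Longrightarrow> d \<in> A \<Longrightarrow> p \<in> fst c \<Longrightarrow> p \<in> fst d \<Longrightarrow> (snd d \<circ> chart_inv c) differentiable (at (snd c p))"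
  using mfd smooth_on_differentiable[of "snd c ` (fst c \<inter> fst d)" "snd d \<circ> chart_inv c" "snd c p"]
  unfolding smooth_manifold_def by blast

lemma transition_linear:
  "c \<in> A \<Longrightarrow> d \<in> A \<Longrightarrow> p \<in> fst c \<Longrightarrow> p \<in> fst d \<Longrightarrow> linear (transition_deriv c d p)"
  unfolding transition_deriv_def by (intro linear_frechet_derivative transition_differentiable)

lemma transition_self:
  assumes "c \<in> A" "p \<in> fst c"
  shows "transition_deriv c c p v = v"
proof -
  have "((\<lambda>x. x) has_derivative (\<lambda>h. h)) (at (snd c p))" by simp
  then have "((snd c \<circ> chart_inv c) has_derivative (\<lambda>h. h)) (at (snd c p))"
    by (rule has_derivative_transform_within_open[OF _ chart_open[OF assms(1)]])
      (use assms chart_inv_left[OF assms(1)] in auto)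
  then show ?thesis unfolding transition_deriv_def using frechet_derivative_at by metis
qed

lemma transition_compose:
  assumes cde: "c \<in> A" "d \<in> A" "e \<in> A" and p: "p \<in> fst c" "p \<in> fst d" "p \<in> fst e"
  shows "transition_deriv d e p (transition_deriv c d p v) = transition_deriv c e p v"
proof -
  have x: "(snd d \<circ> chart_inv c) (snd c p) = snd d p" using chart_inv_left cde p by simp
  have d1: "((snd d \<circ> chart_inv c) has_derivative transition_deriv c d p) (at (snd c p))"
    unfolding transition_deriv_def using transition_differentiable[OF cde(1,2) p(1,2)] frechet_derivative_works by blast
  have d2: "((snd e \<circ> chart_inv d) has_derivative transition_deriv d e p) (at ((snd d \<circ> chart_inv c) (snd c p)))"
    unfolding transition_deriv_def x using transition_differentiable[OF cde(2,3) p(2,3)] frechet_derivative_works by blast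
  have "((snd e \<circ> chart_inv c) has_derivative (transition_deriv d e p \<circ> transition_deriv c d p)) (at (snd c p))"
  proof (rule has_derivative_transform_within_open[OF diff_chain_at[OF d1 d2] overlap_open[OF cde(1,2)]])
    show "snd c p \<in> snd c ` (fst c \<inter> fst d)" using p by blast
    fix y assume "y \<in> snd c ` (fst c \<inter> fst d)"
    then obtain q where "q \<in> fst c" "q \<in> fst d" "y = snd c q" by blast
    then show "((snd e \<circ> chart_inv d) \<circ> (snd d \<circ> chart_inv c)) y = (snd e \<circ> chart_inv c) y"
      using chart_inv_left[OF cde(1), of q] chart_inv_left[OF cde(2), of q] by simp
  qed
  then have "frechet_derivative (snd e \<circ> chart_inv c) (at (snd c p)) = transition_deriv d e p \<circ> transition_deriv c d p"
    using frechet_derivative_at by metis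
  then show ?thesis unfolding transition_deriv_def[of c e p] by simp
qed

text \<open>The tangent vector at \<open>p\<close> with coordinate tuple \<open>v\<close> in the chart \<open>c\<close>.\<close>

definition tvec :: "('a, 'n) chart \<Rightarrow> 'a \<Rightarrow> real ^ 'n \<Rightarrow> ('a, 'n) tangent" where
  "tvec c p v = (\<lambda>d. if d \<in> A \<and> p \<in> fst d then transition_deriv c d p v else 0)"

lemma coord_vector_tvec: "coord_vector A c i p = tvec c p (axis i 1)"
  by (simp add: coord_vector_def tvec_def)

lemma tvec_tangent: "c \<in> A \<Longrightarrow> p \<in> fst c \<Longrightarrow> tvec c p v \<in> tangent_space A p"
  unfolding tangent_space_def tvec_def by (auto simp: transition_compose)

lemma tvec_self: "c \<in> A \<Longrightarrow> p \<in> fst c \<Longrightarrow> tvec c p v c = v"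
  unfolding tvec_def using transition_self by simp

text \<open>Every tangent vector is determined by its coordinates in one chart.\<close>

lemma tvec_collapse:
  assumes "c \<in> A" "p \<in> fst c" "U \<in> tangent_space A p"
  shows "tvec c p (U c) = U"
proof
  fix d
  show "tvec c p (U c) d = U d"
  proof (cases "d \<in> A \<and> p \<in> fst d")
    case True
    then have "U d = transition_deriv c d p (U c)" using assms unfolding tangent_space_def by blast
    then show ?thesis using True by (simp add: tvec_def)
  next
    case False
    then have "U d = 0" using assms(3) unfolding tangent_space_def by blast
    then show ?thesis using False by (simp only: tvec_def if_False)
  qed
qed

lemma tvec_lincomb:
  assumes "c \<in> A" "p \<in> fst c"
  shows "tvec c p (a *\<^sub>R u + b *\<^sub>R v) = (\<lambda>d. a *\<^sub>R tvec c p u d + b *\<^sub>R tvec c p v d)"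
proof
  fix d
  show "tvec c p (a *\<^sub>R u + b *\<^sub>R v) d = a *\<^sub>R tvec c p u d + b *\<^sub>R tvec c p v d"
  proof (cases "d \<in> A \<and> p \<in> fst d")
    case True
    then have "linear (transition_deriv c d p)" using transition_linear assms by blast
    then show ?thesis using True by (simp add: tvec_def linear_add linear_scale)
  next
    case False
    then show ?thesis by (simp only: tvec_def if_False scaleR_zero_right add_0)
  qed
qed

lemma tvec_eq_0_iff:
  assumes "c \<in> A" "p \<in> fst c"
  shows "tvec c p v = (\<lambda>d. 0) \<longleftrightarrow> v = 0"
  using tvec_lincomb[OF assms, of 0 0 0 0] tvec_self[OF assms, of v] by auto

lemma velocity_tvec:
  assumes c: "c \<in> A" and J: "open J" "t \<in> J" "\<gamma> ` J \<subseteq> fst c"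
    and d: "((snd c \<circ> \<gamma>) has_vector_derivative p) (at t)"
  shows "velocity A \<gamma> t = tvec c (\<gamma> t) p"
proof
  fix e
  show "velocity A \<gamma> t e = tvec c (\<gamma> t) p e"
  proof (cases "e \<in> A \<and> \<gamma> t \<in> fst e")
    case True
    have \<gamma>c: "\<gamma> t \<in> fst c" using J by blast
    have d1: "((snd c \<circ> \<gamma>) has_derivative (\<lambda>h. h *\<^sub>R p)) (at t)"
      using d by (simp add: has_vector_derivative_def)
    have d2: "((snd e \<circ> chart_inv c) has_derivative transition_deriv c e (\<gamma> t)) (at ((snd c \<circ> \<gamma>) t))"
      unfolding transition_deriv_def using transition_differentiable[of c e "\<gamma> t"] c True \<gamma>c frechet_derivative_works
      by (metis comp_apply)
    have l: "linear (transition_deriv c e (\<gamma> t))" using transition_linear c True \<gamma>c by blast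
    have "((snd e \<circ> \<gamma>) has_derivative (transition_deriv c e (\<gamma> t) \<circ> (\<lambda>h. h *\<^sub>R p))) (at t)"
      by (rule has_derivative_transform_within_open[OF diff_chain_at[OF d1 d2] J(1,2)])
        (use J chart_inv_left[OF c] in auto)
    then have "((snd e \<circ> \<gamma>) has_vector_derivative transition_deriv c e (\<gamma> t) p) (at t)"
      unfolding has_vector_derivative_def by (simp add: o_def linear_scale[OF l])
    then show ?thesis using True by (simp add: velocity_def tvec_def vector_derivative_at)
  qed (auto simp: velocity_def tvec_def)
qed

end

section \<open>The metric in a chart\<close>

locale pseudo_riemannian_mfd = smooth_mfd X A
  for X :: "'a topology" and A :: "('a, 'n::finite) chart set" +
  fixes g :: "('a, 'n) metric"
  assumes metric: "pseudo_riemannian_metric X A g"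
begin

lemma metric_linear_left:
  assumes "c \<in> A" "p \<in> fst c" "W \<in> tangent_space A p"
  shows "linear (\<lambda>u. g p (tvec c p u) W)"
proof -
  have p: "p \<in> topspace X" using chart_subset assms by blast
  have l: "g p (tvec c p (a *\<^sub>R u + b *\<^sub>R v)) W = a * g p (tvec c p u) W + b * g p (tvec c p v) W" for a b u v
    unfolding tvec_lincomb[OF assms(1,2)]
    using metric p assms tvec_tangent[OF assms(1,2)] unfolding pseudo_riemannian_metric_def by blast
  show ?thesis
  proof (rule linearI)
    show "g p (tvec c p (u + v)) W = g p (tvec c p u) W + g p (tvec c p v) W" for u v
      using l[of 1 u 1 v] by simp
    show "g p (tvec c p (a *\<^sub>R u)) W = a *\<^sub>R g p (tvec c p u) W" for a u
      using l[of a u 0 0] by simp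
  qed
qed

lemma metric_sym:
  "c \<in> A \<Longrightarrow> p \<in> fst c \<Longrightarrow> g p (tvec c p u) (tvec c p v) = g p (tvec c p v) (tvec c p u)"
  using metric chart_subset tvec_tangent unfolding pseudo_riemannian_metric_def by blast

lemma metric_bilinear:
  assumes "c \<in> A" "p \<in> fst c"
  shows "bilinear (\<lambda>u v. g p (tvec c p u) (tvec c p v))"
proof -
  have l: "linear (\<lambda>u. g p (tvec c p u) (tvec c p v))" for v
    by (rule metric_linear_left[OF assms tvec_tangent[OF assms]])
  have "linear (\<lambda>v. g p (tvec c p u) (tvec c p v))" for u
    using l[of u] unfolding metric_sym[OF assms, of u] .
  with l show ?thesis unfolding bilinear_def by blast
qed

lemma metric_nondegenerate:
  assumes c: "c \<in> A" "p \<in> fst c" and "\<And>v. g p (tvec c p u) (tvec c p v) = 0"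
  shows "u = 0"
proof -
  have "\<forall>V\<in>tangent_space A p. g p (tvec c p u) V = 0"
    using assms(3) tvec_collapse[OF c] by metis
  then have "tvec c p u = (\<lambda>d. 0)"
    using metric chart_subset[OF c] tvec_tangent[OF c] unfolding pseudo_riemannian_metric_def by blast
  then show ?thesis using tvec_eq_0_iff[OF c] by blast
qed

lemma metric_matrix_entry:
  "c \<in> A \<Longrightarrow> p \<in> fst c \<Longrightarrow>
    metric_matrix A g c (snd c p) $ i $ j = g p (tvec c p (axis i 1)) (tvec c p (axis j 1))"
  by (simp add: metric_matrix_def Let_def chart_inv_left coord_vector_tvec)

lemma metric_expand:
  assumes c: "c \<in> A" "p \<in> fst c"
  shows "g p (tvec c p u) (tvec c p v) =
    (\<Sum>i\<in>UNIV. \<Sum>j\<in>UNIV. u $ i * v $ j * metric_matrix A g c (snd c p) $ i $ j)"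
proof -
  let ?b = "\<lambda>u v. g p (tvec c p u) (tvec c p v)"
  have b: "bilinear ?b" by (rule metric_bilinear[OF c])
  have l: "linear (\<lambda>u. ?b u w)" "linear (\<lambda>v. ?b w v)" for w using b unfolding bilinear_def by auto
  have ex: "w = (\<Sum>i\<in>UNIV. w $ i *\<^sub>R axis i 1)" for w :: "real ^ 'n"
    using basis_expansion[of w] by (simp add: scalar_mult_eq_scaleR)
  have "?b u v = ?b (\<Sum>i\<in>UNIV. u $ i *\<^sub>R axis i 1) (\<Sum>j\<in>UNIV. v $ j *\<^sub>R axis j 1)" using ex by metis
  also have "\<dots> = (\<Sum>i\<in>UNIV. u $ i * ?b (axis i 1) (\<Sum>j\<in>UNIV. v $ j *\<^sub>R axis j 1))"
    by (subst linear_sum[OF l(1)]) (simp add: linear_scale[OF l(1)])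
  also have "\<dots> = (\<Sum>i\<in>UNIV. u $ i * (\<Sum>j\<in>UNIV. v $ j * ?b (axis i 1) (axis j 1)))"
    by (intro sum.cong refl, subst linear_sum[OF l(2)]) (simp add: linear_scale[OF l(2)])
  finally show ?thesis by (simp add: metric_matrix_entry[OF c] sum_distrib_left mult.assoc)
qed

lemma metric_matrix_sym:
  assumes "c \<in> A" "x \<in> snd c ` fst c"
  shows "metric_matrix A g c x $ i $ j = metric_matrix A g c x $ j $ i"
proof -
  obtain p where "p \<in> fst c" "x = snd c p" using assms(2) by blast
  then show ?thesis using metric_matrix_entry[OF assms(1), of p] metric_sym[OF assms(1), of p] by simp
qed

lemma metric_matrix_smooth:
  "c \<in> A \<Longrightarrow> smooth_on (snd c ` fst c) (\<lambda>x. metric_matrix A g c x $ i $ j)"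
  using metric unfolding pseudo_riemannian_metric_def by blast

lemma metric_matrix_dsym:
  assumes "c \<in> A" "x \<in> snd c ` fst c"
  shows "pderiv_at k (\<lambda>y. metric_matrix A g c y $ i $ j) x = pderiv_at k (\<lambda>y. metric_matrix A g c y $ j $ i) x"
  by (rule pderiv_at_cong[OF chart_open[OF assms(1)] assms(2) metric_matrix_sym[OF assms(1)]])
    (use smooth_on_differentiable[OF metric_matrix_smooth] assms in auto)

lemma metric_matrix_invertible:
  assumes c: "c \<in> A" and x: "x \<in> snd c ` fst c"
  shows "invertible (metric_matrix A g c x)"
proof -
  let ?G = "metric_matrix A g c x"
  obtain p where p: "p \<in> fst c" "x = snd c p" using x by blast
  have "w = 0" if w: "?G *v w = 0" for w
  proof (rule metric_nondegenerate[OF c p(1)])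
    fix v
    have "g p (tvec c p w) (tvec c p v) = (\<Sum>i\<in>UNIV. v $ i * (\<Sum>j\<in>UNIV. ?G $ i $ j * w $ j))"
      unfolding metric_sym[OF c p(1), of w v]
      unfolding metric_expand[OF c p(1)] p(2)
      by (simp add: sum_distrib_left mult_ac)
    also have "\<dots> = (\<Sum>i\<in>UNIV. v $ i * (?G *v w) $ i)" by (simp add: matrix_vector_mult_def)
    finally show "g p (tvec c p w) (tvec c p v) = 0" by (simp add: w)
  qed
  then have "\<exists>B. B ** ?G = mat 1" using matrix_left_invertible_ker by blast
  then show ?thesis using invertible_left_inverse by blast
qed

lemma christoffel_smooth: "c \<in> A \<Longrightarrow> smooth_on (snd c ` fst c) (christoffel (metric_matrix A g c) k i j)"
  by (intro smooth_on_christoffel chart_open metric_matrix_smooth metric_matrix_invertible)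

text \<open>The length of the velocity of a geodesic is conserved.\<close>

lemma geodesic_energy:
  assumes c: "c \<in> A" and J: "open J" "\<gamma> ` J \<subseteq> fst c" and t: "t \<in> J"
    and ode: "\<And>s. s \<in> J \<Longrightarrow> ((snd c \<circ> \<gamma>) has_vector_derivative x' s) (at s)"
      "\<And>s. s \<in> J \<Longrightarrow> (x' has_vector_derivative
              (\<chi> k. - (\<Sum>i\<in>UNIV. \<Sum>j\<in>UNIV.
                 christoffel (metric_matrix A g c) k i j (snd c (\<gamma> s)) * x' s $ i * x' s $ j))) (at s)"
  shows "((\<lambda>s. g (\<gamma> s) (velocity A \<gamma> s) (velocity A \<gamma> s)) has_real_derivative 0) (at t)"
proof -
  let ?G = "metric_matrix A g c"
  have x: "snd c (\<gamma> s) \<in> snd c ` fst c" if "s \<in> J" for s using J that by blast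
  have "((\<lambda>s. \<Sum>i\<in>UNIV. \<Sum>j\<in>UNIV. x' s $ i * x' s $ j * ?G ((snd c \<circ> \<gamma>) s) $ i $ j) has_real_derivative 0) (at t)"
    using smooth_on_differentiable[OF metric_matrix_smooth[OF c] x[OF t]] ode[OF t]
      metric_matrix_sym[OF c x[OF t]] metric_matrix_dsym[OF c x[OF t]]
      metric_matrix_invertible[OF c x[OF t]]
    by (intro energy_derivative_zero) (auto simp: comp_def)
  moreover have "g (\<gamma> s) (velocity A \<gamma> s) (velocity A \<gamma> s) =
      (\<Sum>i\<in>UNIV. \<Sum>j\<in>UNIV. x' s $ i * x' s $ j * ?G ((snd c \<circ> \<gamma>) s) $ i $ j)" if "s \<in> J" for s
    using velocity_tvec[OF c J(1) that J(2) ode(1)[OF that]] metric_expand[OF c, of "\<gamma> s"] J(2) that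
    by (auto simp: image_subset_iff)
  ultimately show ?thesis
    using has_field_derivative_transform_within_open[OF _ J(1) t] by simp
qed

text \<open>Every nonzero null vector is the velocity at parameter \<open>0\<close> of a light-line geodesic, which may be
  taken to stay inside a given chart.\<close>

lemma null_geodesic_exists:
  assumes c: "c \<in> A" "p \<in> fst c" and v: "v \<noteq> 0" and null: "g p (tvec c p v) (tvec c p v) = 0"
  obtains \<epsilon> \<gamma> where "\<epsilon> > 0" "light_line_geodesic A g {-\<epsilon><..<\<epsilon>} \<gamma>" "\<gamma> 0 = p"
    "\<gamma> ` {-\<epsilon><..<\<epsilon>} \<subseteq> fst c" "((snd c \<circ> \<gamma>) has_vector_derivative v) (at 0)"
proof -
  let ?S = "snd c ` fst c"
  obtain \<epsilon> x x' where \<epsilon>: "\<epsilon> > 0" and x0: "x 0 = snd c p" "x' 0 = v"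
    and sol: "\<forall>t\<in>{-\<epsilon><..<\<epsilon>}. x t \<in> ?S"
      "\<forall>t\<in>{-\<epsilon><..<\<epsilon>}. (x has_vector_derivative x' t) (at t)"
      "\<forall>t\<in>{-\<epsilon><..<\<epsilon>}. (x' has_vector_derivative
        (\<chi> k. - (\<Sum>i\<in>UNIV. \<Sum>j\<in>UNIV. christoffel (metric_matrix A g c) k i j (x t) * x' t $ i * x' t $ j))) (at t)"
    by (rule geodesic_exists_local[where \<Gamma> = "christoffel (metric_matrix A g c)" and v = v,
          OF chart_open[OF c(1)] christoffel_smooth[OF c(1)] imageI[OF c(2)]]) (rule that)
  note xS = sol(1)[rule_format] and dx = sol(2)[rule_format] and dx' = sol(3)[rule_format]
  let ?I = "{-\<epsilon><..<\<epsilon>}"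
  define \<gamma> where "\<gamma> t = chart_inv c (x t)" for t
  have \<gamma>c: "\<gamma> ` ?I \<subseteq> fst c"
    by (rule image_subsetI) (simp only: \<gamma>_def chart_inv_in[OF xS])
  have xe: "snd c (\<gamma> t) = x t" if "t \<in> ?I" for t using chart_inv_right[OF xS[OF that]] by (simp add: \<gamma>_def)
  have d\<gamma>: "((snd c \<circ> \<gamma>) has_vector_derivative x' t) (at t)" if "t \<in> ?I" for t
    by (rule has_vector_derivative_transform_within_open[OF dx[OF that] _ that]) (use xe in auto)
  have d\<gamma>': "(x' has_vector_derivative
        (\<chi> k. - (\<Sum>i\<in>UNIV. \<Sum>j\<in>UNIV. christoffel (metric_matrix A g c) k i j (snd c (\<gamma> t)) * x' t $ i * x' t $ j))) (at t)"
    if "t \<in> ?I" for t using dx'[OF that] unfolding xe[OF that] .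
  have I0: "0 \<in> ?I" using \<epsilon> by simp
  have \<gamma>0: "\<gamma> 0 = p" using chart_inv_left[OF c] by (simp add: \<gamma>_def x0)
  have "geodesic A g ?I \<gamma>"
    unfolding geodesic_def using c(1) \<gamma>c d\<gamma> d\<gamma>'
    by (intro conjI ballI bexI[of _ c] exI[of _ ?I] exI[of _ x']) (auto simp: is_interval_oo)
  moreover have "\<not> \<gamma> constant_on ?I"
  proof
    assume "\<gamma> constant_on ?I"
    then obtain q where q: "\<And>t. t \<in> ?I \<Longrightarrow> \<gamma> t = q" unfolding constant_on_def by blast
    have "((snd c \<circ> \<gamma>) has_vector_derivative 0) (at 0)"
      by (rule has_vector_derivative_transform_within_open[OF has_vector_derivative_const[of "snd c q"] _ I0])
        (use q in auto)
    then show False using vector_derivative_unique_at[OF d\<gamma>[OF I0]] v x0 by simp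
  qed
  moreover have "g (\<gamma> t) (velocity A \<gamma> t) (velocity A \<gamma> t) = 0" if t: "t \<in> ?I" for t
  proof -
    have "\<exists>k. \<forall>t\<in>?I. g (\<gamma> t) (velocity A \<gamma> t) (velocity A \<gamma> t) = k"
      by (rule has_field_derivative_zero_constant[OF _ has_field_derivative_at_within[OF
            geodesic_energy[OF c(1) open_greaterThanLessThan \<gamma>c _ d\<gamma> d\<gamma>']]]) auto
    then have "g (\<gamma> t) (velocity A \<gamma> t) (velocity A \<gamma> t) = g (\<gamma> 0) (velocity A \<gamma> 0) (velocity A \<gamma> 0)"
      using t I0 by metis
    also have "velocity A \<gamma> 0 = tvec c p v"
      using velocity_tvec[OF c(1) _ I0 \<gamma>c d\<gamma>[OF I0]] x0 \<gamma>0 by simp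
    finally show ?thesis using null \<gamma>0 by simp
  qed
  ultimately have "light_line_geodesic A g ?I \<gamma>" unfolding light_line_geodesic_def by blast
  then show ?thesis using that[OF \<epsilon> _ \<gamma>0 \<gamma>c] d\<gamma>[OF I0] x0 by simp
qed

end

section \<open>Indefinite metrics are indefinite at every point\<close>

text \<open>Otherwise an isotropic \<open>u\<close> with \<open>b u v \<noteq> 0\<close> would give negative values on the line \<open>v + s u\<close>.\<close>

lemma semidefinite_imp_definite:
  fixes b :: "'v::real_vector \<Rightarrow> 'v \<Rightarrow> real"
  assumes bl: "bilinear b" and sym: "\<And>u v. b u v = b v u"
    and nondeg: "\<And>u. (\<And>v. b u v = 0) \<Longrightarrow> u = 0"
    and semi: "\<And>v. b v v \<ge> 0" and u: "u \<noteq> 0"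
  shows "b u u > 0"
proof (rule ccontr)
  assume "\<not> b u u > 0"
  then have u0: "b u u = 0" using semi[of u] by simp
  have "b u v = 0" for v
  proof (rule ccontr)
    assume nz: "b u v \<noteq> 0"
    define s where "s = - (b v v + 1) / (2 * b u v)"
    have "0 \<le> b (v + s *\<^sub>R u) (v + s *\<^sub>R u)" by (rule semi)
    also have "\<dots> = b v v + 2 * s * b u v"
      using sym[of v u] u0
      by (simp add: bilinear_ladd[OF bl] bilinear_radd[OF bl] bilinear_lmul[OF bl] bilinear_rmul[OF bl])
    also have "2 * s * b u v = - (b v v + 1)" using nz by (simp add: s_def)
    finally show False by simp
  qed
  then show False using nondeg u by blast
qed

text \<open>The minimum of the form on the compact unit sphere is positive, and it stays so under a small change
  of the entries.\<close>

lemma open_positive_definite: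
  fixes G :: "'a::euclidean_space \<Rightarrow> real ^ 'n ^ 'n"
  assumes S: "open S" and cont: "\<And>i j. continuous_on S (\<lambda>x. G x $ i $ j)"
  shows "open {x \<in> S. \<forall>w. w \<noteq> 0 \<longrightarrow> (\<Sum>i\<in>UNIV. \<Sum>j\<in>UNIV. w $ i * w $ j * G x $ i $ j) > 0}"
    (is "open ?D")
proof (rule open_subopen[THEN iffD2], intro ballI)
  let ?Q = "\<lambda>x w. \<Sum>i\<in>UNIV. \<Sum>j\<in>UNIV. w $ i * w $ j * G x $ i $ j"
  fix y assume y: "y \<in> ?D"
  let ?K = "sphere 0 1 :: (real ^ 'n) set"
  have ne: "?K \<noteq> {}" by simp
  have ct: "continuous_on ?K (?Q y)" by (intro continuous_intros)
  obtain w0 where w0: "w0 \<in> ?K" "\<forall>w\<in>?K. ?Q y w0 \<le> ?Q y w"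
    using continuous_attains_inf[OF compact_sphere ne ct] by blast
  define m where "m = ?Q y w0"
  have "w0 \<noteq> 0" using w0(1) by auto
  then have m: "m > 0" using y unfolding m_def by simp
  define e where "e x = (\<Sum>i\<in>UNIV. \<Sum>j\<in>UNIV. \<bar>G x $ i $ j - G y $ i $ j\<bar>)" for x
  have "continuous_on S e" unfolding e_def by (intro continuous_intros cont)
  then have "open (S \<inter> e -` {..<m})" using S by (intro continuous_open_preimage) auto
  moreover have "y \<in> S \<inter> e -` {..<m}" using y m by (simp add: e_def)
  moreover have "?Q x w > 0" if x: "x \<in> S" "e x < m" and w: "w \<noteq> 0" for x w
  proof -
    define u where "u = (1 / norm w) *\<^sub>R w"
    have u: "norm u = 1" using w by (simp add: u_def)
    have "\<bar>?Q x u - ?Q y u\<bar> \<le> e x"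
    proof -
      have "?Q x u - ?Q y u = (\<Sum>i\<in>UNIV. \<Sum>j\<in>UNIV. u $ i * u $ j * (G x $ i $ j - G y $ i $ j))"
        by (simp add: sum_subtractf right_diff_distrib)
      also have "\<bar>\<dots>\<bar> \<le> (\<Sum>i\<in>UNIV. \<Sum>j\<in>UNIV. \<bar>u $ i * u $ j * (G x $ i $ j - G y $ i $ j)\<bar>)"
        by (rule order_trans[OF sum_abs sum_mono]) (rule sum_abs)
      also have "\<dots> \<le> e x"
        unfolding e_def
      proof (intro sum_mono)
        fix i j
        have "\<bar>u $ i\<bar> * \<bar>u $ j\<bar> \<le> 1 * 1"
          using component_le_norm_cart[of u] u by (intro mult_mono) auto
        then show "\<bar>u $ i * u $ j * (G x $ i $ j - G y $ i $ j)\<bar> \<le> \<bar>G x $ i $ j - G y $ i $ j\<bar>"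
          by (simp add: abs_mult mult_left_le_one_le)
      qed
      finally show ?thesis .
    qed
    moreover have "m \<le> ?Q y u" using w0(2) u by (simp add: m_def)
    ultimately have "?Q x u > 0" using x(2) by linarith
    moreover have "?Q x w = (norm w)\<^sup>2 * ?Q x u"
      using w by (simp add: u_def sum_distrib_left power2_eq_square field_simps)
    ultimately show "?Q x w > 0" using w by simp
  qed
  then have "S \<inter> e -` {..<m} \<subseteq> ?D" by auto
  ultimately show "\<exists>T. open T \<and> y \<in> T \<and> T \<subseteq> ?D" by blast
qed

context pseudo_riemannian_mfd
begin

lemma pseudo_riemannian_scale:
  assumes "k \<noteq> 0"
  shows "pseudo_riemannian_metric X A (\<lambda>p u v. k * g p u v)"
proof -
  have "smooth_on (snd c ` fst c) (\<lambda>x. metric_matrix A (\<lambda>p u v. k * g p u v) c x $ i $ j)" if "c \<in> A" for c i j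
  proof -
    have "smooth_on (snd c ` fst c) (\<lambda>x. k * metric_matrix A g c x $ i $ j)"
      by (intro smooth_on_mult smooth_on_const metric_matrix_smooth chart_open that)
    then show ?thesis by (simp add: metric_matrix_def Let_def)
  qed
  then show ?thesis
    using metric assms unfolding pseudo_riemannian_metric_def
    by (simp add: distrib_left mult.left_commute)
qed

text \<open>The metric is definite at \<open>p\<close>: positive for \<open>\<sigma> = 1\<close> and negative for \<open>\<sigma> = -1\<close>.\<close>

definition definite_at :: "real \<Rightarrow> 'a \<Rightarrow> bool" where
  "definite_at \<sigma> p \<longleftrightarrow> (\<forall>U\<in>tangent_space A p. U \<noteq> (\<lambda>c. 0) \<longrightarrow> \<sigma> * g p U U > 0)"

lemma definite_at_chart:
  assumes c: "c \<in> A" "p \<in> fst c"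
  shows "definite_at \<sigma> p \<longleftrightarrow> (\<forall>w. w \<noteq> 0 \<longrightarrow>
    (\<Sum>i\<in>UNIV. \<Sum>j\<in>UNIV. w $ i * w $ j * (\<sigma> *\<^sub>R metric_matrix A g c (snd c p)) $ i $ j) > 0)"
proof -
  have "definite_at \<sigma> p \<longleftrightarrow> (\<forall>w. w \<noteq> 0 \<longrightarrow> \<sigma> * g p (tvec c p w) (tvec c p w) > 0)"
    unfolding definite_at_def using tvec_collapse[OF c] tvec_tangent[OF c] tvec_eq_0_iff[OF c] by metis
  then show ?thesis
    unfolding metric_expand[OF c] by (simp add: sum_distrib_left mult_ac)
qed

lemma definite_open:
  assumes c: "c \<in> A"
  shows "open {x \<in> snd c ` fst c. definite_at \<sigma> (chart_inv c x)}"
proof -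
  have "continuous_on (snd c ` fst c) (\<lambda>x. (\<sigma> *\<^sub>R metric_matrix A g c x) $ i $ j)" for i j
    using smooth_on_continuous_on[OF metric_matrix_smooth[OF c]] by (auto intro: continuous_intros)
  from open_positive_definite[OF chart_open[OF c] this]
  show ?thesis
    by (rule back_subst[where P = "open"])
      (use definite_at_chart[OF c] chart_inv_left[OF c] in auto)
qed

lemma not_definite_imp:
  assumes c: "c \<in> A" "p \<in> fst c" and "\<not> definite_at 1 p" "\<not> definite_at (-1) p"
  shows "\<exists>u v. g p (tvec c p u) (tvec c p u) > 0 \<and> g p (tvec c p v) (tvec c p v) < 0"
proof -
  let ?b = "\<lambda>u v. g p (tvec c p u) (tvec c p v)"
  have bl: "bilinear ?b" by (rule metric_bilinear[OF c])
  have l: "linear (\<lambda>u. ?b u w)" "linear (\<lambda>v. ?b w v)" for w using bl unfolding bilinear_def by auto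
  have blm: "bilinear (\<lambda>u v. - ?b u v)"
    unfolding bilinear_def using l by (auto intro: linear_compose_neg)
  have d: "definite_at \<sigma> p \<longleftrightarrow> (\<forall>w. w \<noteq> 0 \<longrightarrow> \<sigma> * ?b w w > 0)" for \<sigma>
    unfolding definite_at_def using tvec_collapse[OF c] tvec_tangent[OF c] tvec_eq_0_iff[OF c] by metis
  have "\<exists>v. ?b v v < 0"
  proof (rule ccontr)
    assume "\<not> (\<exists>v. ?b v v < 0)"
    then have "?b u u > 0" if "u \<noteq> 0" for u
      using semidefinite_imp_definite[where b = ?b, OF bl metric_sym[OF c] metric_nondegenerate[OF c] _ that]
        \<open>\<not> (\<exists>v. ?b v v < 0)\<close> by (simp add: not_less)
    then show False using assms(3) d by simp
  qed
  moreover have "\<exists>v. ?b v v > 0"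
  proof (rule ccontr)
    assume "\<not> (\<exists>v. ?b v v > 0)"
    then have "- ?b u u > 0" if "u \<noteq> 0" for u
      using semidefinite_imp_definite[where b = "\<lambda>u v. - ?b u v", OF blm _ _ _ that] metric_sym[OF c]
        metric_nondegenerate[OF c] \<open>\<not> (\<exists>v. ?b v v > 0)\<close> by (simp add: not_less)
    then show False using assms(4) d by simp
  qed
  ultimately show ?thesis by blast
qed

lemma not_definite_chart:
  assumes c: "c \<in> A" "p \<in> fst c"
  shows "\<not> definite_at 1 p \<and> \<not> definite_at (-1) p \<longleftrightarrow>
    (\<exists>u v. g p (tvec c p u) (tvec c p u) > 0 \<and> g p (tvec c p v) (tvec c p v) < 0)"
proof
  assume "\<exists>u v. g p (tvec c p u) (tvec c p u) > 0 \<and> g p (tvec c p v) (tvec c p v) < 0"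
  then obtain u v where u: "g p (tvec c p u) (tvec c p u) > 0" and v: "g p (tvec c p v) (tvec c p v) < 0" by blast
  have "u \<noteq> 0" "v \<noteq> 0"
    using u v linear_0[OF metric_linear_left[OF c tvec_tangent[OF c]]] by auto
  then show "\<not> definite_at 1 p \<and> \<not> definite_at (-1) p"
    unfolding definite_at_def using u v tvec_tangent[OF c] tvec_eq_0_iff[OF c]
    by (smt (verit) mult_minus1 mult_cancel_right1 mult_1)
qed (use not_definite_imp[OF c] in blast)

lemma not_definite_open:
  assumes c: "c \<in> A"
  shows "open {x \<in> snd c ` fst c. \<not> definite_at 1 (chart_inv c x) \<and> \<not> definite_at (-1) (chart_inv c x)}"
proof -
  let ?S = "snd c ` fst c"
  let ?Q = "\<lambda>w x. \<Sum>i\<in>UNIV. \<Sum>j\<in>UNIV. w $ i * w $ j * metric_matrix A g c x $ i $ j"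
  have ct: "continuous_on ?S (?Q w)" for w
    by (intro continuous_intros smooth_on_continuous_on metric_matrix_smooth c)
  have nd: "\<not> definite_at 1 (chart_inv c x) \<and> \<not> definite_at (-1) (chart_inv c x) \<longleftrightarrow>
      (\<exists>u v. ?Q u x > 0 \<and> ?Q v x < 0)" if x: "x \<in> ?S" for x
  proof -
    obtain p where p: "p \<in> fst c" "x = snd c p" using x by blast
    show ?thesis
      unfolding p(2) chart_inv_left[OF c p(1)] not_definite_chart[OF c p(1)] metric_expand[OF c p(1)] ..
  qed
  have "open (?S \<inter> ?Q w -` {0<..})" "open (?S \<inter> ?Q w -` {..<0})" for w
    by (intro continuous_open_preimage ct chart_open c open_greaterThan open_lessThan)+
  then have "open (\<Union>u v. (?S \<inter> ?Q u -` {0<..}) \<inter> (?S \<inter> ?Q v -` {..<0}))" by blast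
  also have "(\<Union>u v. (?S \<inter> ?Q u -` {0<..}) \<inter> (?S \<inter> ?Q v -` {..<0})) =
      {x \<in> ?S. \<not> definite_at 1 (chart_inv c x) \<and> \<not> definite_at (-1) (chart_inv c x)}"
    by (simp only: set_eq_iff UN_iff Int_iff vimage_eq greaterThan_iff lessThan_iff mem_Collect_eq)
      (use nd in blast)
  finally show ?thesis .
qed

lemma definite_unique:
  assumes "p \<in> topspace X" "definite_at 1 p" "definite_at (-1) p"
  shows False
proof -
  obtain c where c: "c \<in> A" "p \<in> fst c" using covered assms(1) by blast
  have "axis undefined 1 \<noteq> (0 :: real ^ 'n)" by simp
  then show False
    using assms(2,3) tvec_tangent[OF c, of "axis undefined 1"] tvec_eq_0_iff[OF c, of "axis undefined 1"]
    unfolding definite_at_def by fastforce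
qed

text \<open>The manifold is the disjoint union of the open sets where the metric is positive definite,
  negative definite, and indefinite, so by connectedness only one of them is nonempty.
  If it is one of the first two, then \<open>g\<close> or \<open>-g\<close> is Riemannian.\<close>

lemma indefinite_everywhere:
  assumes conn: "connected_space X" and ind: "indefinite_metric X A g" and p: "p \<in> topspace X"
  shows "\<not> definite_at 1 p \<and> \<not> definite_at (-1) p"
proof -
  have "\<not> definite_at \<sigma> p" if \<sigma>: "\<sigma> = 1 \<or> \<sigma> = -1" for \<sigma>
  proof
    assume d: "definite_at \<sigma> p"
    have "definite_at \<sigma> q" if q: "q \<in> topspace X" for q
    proof (rule connected_constant_property[where P = "definite_at \<sigma>", OF conn p d definite_open _ q])
      fix c assume c: "c \<in> A"
      let ?S = "snd c ` fst c"
      have alt: "definite_at (-\<sigma>) r \<or> (\<not> definite_at 1 r \<and> \<not> definite_at (-1) r) \<longleftrightarrow> \<not> definite_at \<sigma> r"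
        if "r \<in> topspace X" for r using \<sigma> definite_unique[OF that] by auto
      have "open ({x \<in> ?S. definite_at (-\<sigma>) (chart_inv c x)} \<union>
          {x \<in> ?S. \<not> definite_at 1 (chart_inv c x) \<and> \<not> definite_at (-1) (chart_inv c x)})"
        by (intro open_Un definite_open not_definite_open c)
      also have "{x \<in> ?S. definite_at (-\<sigma>) (chart_inv c x)} \<union>
          {x \<in> ?S. \<not> definite_at 1 (chart_inv c x) \<and> \<not> definite_at (-1) (chart_inv c x)} =
          {x \<in> ?S. \<not> definite_at \<sigma> (chart_inv c x)}"
        using alt chart_subset[OF c chart_inv_in] by blast
      finally show "open {x \<in> ?S. \<not> definite_at \<sigma> (chart_inv c x)}" .
    qed
    then have "riemannian_metric X A (\<lambda>p u v. \<sigma> * g p u v)"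
      unfolding riemannian_metric_def definite_at_def using pseudo_riemannian_scale[of \<sigma>] \<sigma> by auto
    then show False using ind unfolding indefinite_metric_def by blast
  qed
  then show ?thesis by blast
qed

end

section \<open>The main argument\<close>

text \<open>Two conformally related Einstein metrics on a manifold of dimension at least three.\<close>

locale einstein_pair = pseudo_riemannian_mfd X A g
  for X :: "'a topology" and A :: "('a, 'n::finite) chart set" and g :: "('a, 'n) metric" +
  fixes \<psi> :: "'a \<Rightarrow> real"
  assumes dim: "CARD('n) > 2"
    and einstein: "einstein_metric X A g"
    and psi_smooth: "smooth_function A \<psi>"
    and psi_nz: "p \<in> topspace X \<Longrightarrow> \<psi> p \<noteq> 0"
    and einstein': "einstein_metric X A (\<lambda>p u v. \<psi> p powi (-2) * g p u v)"
begin

text \<open>The coordinate expression of \<open>\<psi>\<close>.\<close>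

definition psi_chart :: "('a, 'n) chart \<Rightarrow> real ^ 'n \<Rightarrow> real" where
  "psi_chart c = \<psi> \<circ> chart_inv c"

lemma psi_chart_smooth: "c \<in> A \<Longrightarrow> smooth_on (snd c ` fst c) (psi_chart c)"
  using psi_smooth unfolding smooth_function_def psi_chart_def by blast

lemma psi_chart_at: "c \<in> A \<Longrightarrow> p \<in> fst c \<Longrightarrow> psi_chart c (snd c p) = \<psi> p"
  by (simp add: psi_chart_def chart_inv_left)

lemma hessian_null:
  assumes c: "c \<in> A" "p \<in> fst c" and null: "g p (tvec c p v) (tvec c p v) = 0"
  shows "(\<Sum>j\<in>UNIV. \<Sum>k\<in>UNIV. v $ j * v $ k *
        (pderiv_at j (pderiv_at k (psi_chart c)) (snd c p)
         - (\<Sum>m\<in>UNIV. christoffel (metric_matrix A g c) m j k (snd c p) * pderiv_at m (psi_chart c) (snd c p)))) = 0"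
    (is "?H = 0")
proof -
  let ?S = "snd c ` fst c" and ?x = "snd c p"
  let ?g' = "\<lambda>p u v. \<psi> p powi (-2) * g p u v"
  let ?G = "metric_matrix A g c" and ?G' = "metric_matrix A ?g' c"
  have x: "?x \<in> ?S" using c by blast
  have nz: "psi_chart c ?x \<noteq> 0" using psi_chart_at[OF c] psi_nz chart_subset[OF c] by simp
  interpret conformal_change ?S ?G ?G' "psi_chart c"
  proof
    show "psi_chart c y \<noteq> 0" if "y \<in> ?S" for y
      using psi_nz chart_subset[OF c(1) chart_inv_in[OF that]] by (simp add: psi_chart_def)
    show "?G' y = inverse ((psi_chart c y)\<^sup>2) *\<^sub>R ?G y" if "y \<in> ?S" for y
      by (simp add: metric_matrix_def Let_def vec_eq_iff psi_chart_def power_int_minus)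
  qed (use chart_open metric_matrix_smooth metric_matrix_invertible metric_matrix_sym psi_chart_smooth c in auto)
  have G0: "(\<Sum>i\<in>UNIV. \<Sum>j\<in>UNIV. v $ i * v $ j * ?G ?x $ i $ j) = 0"
    using null unfolding metric_expand[OF c] .
  have scal: "(\<Sum>i\<in>UNIV. \<Sum>j\<in>UNIV. v $ i * v $ j * (k *\<^sub>R ?G ?x) $ i $ j) = 0" for k
  proof -
    have "(\<Sum>i\<in>UNIV. \<Sum>j\<in>UNIV. v $ i * v $ j * (k *\<^sub>R ?G ?x) $ i $ j) =
      k * (\<Sum>i\<in>UNIV. \<Sum>j\<in>UNIV. v $ i * v $ j * ?G ?x $ i $ j)"
      unfolding sum_distrib_left by (intro sum.cong refl) simp
    then show ?thesis using G0 by simp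
  qed
  have R: "ricci ?G ?x = (scalar_curvature ?G ?x / real CARD('n)) *\<^sub>R ?G ?x"
    using einstein c(1) x unfolding einstein_metric_def by blast
  have r: "(\<Sum>i\<in>UNIV. \<Sum>j\<in>UNIV. v $ i * v $ j * ricci ?G ?x $ i $ j) = 0"
    unfolding R by (rule scal)
  have "ricci ?G' ?x = (scalar_curvature ?G' ?x / real CARD('n)) *\<^sub>R ?G' ?x"
    using einstein' c(1) x unfolding einstein_metric_def by blast
  also have "\<dots> = (scalar_curvature ?G' ?x / real CARD('n) * inverse ((psi_chart c ?x)\<^sup>2)) *\<^sub>R ?G ?x"
    by (simp add: G'[OF x])
  finally have R': "ricci ?G' ?x = (scalar_curvature ?G' ?x / real CARD('n) * inverse ((psi_chart c ?x)\<^sup>2)) *\<^sub>R ?G ?x" .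
  have r': "(\<Sum>i\<in>UNIV. \<Sum>j\<in>UNIV. v $ i * v $ j * ricci ?G' ?x $ i $ j) = 0"
    unfolding R' by (rule scal)
  \<comment> \<open>Both Ricci tensors are multiples of the metric and thus vanish on \<open>v\<close>.\<close>
  have "(real CARD('n) - 2) / psi_chart c ?x * ?H = 0"
    using ricci_null_change[OF x G0] unfolding r r' by simp
  then show ?thesis using dim nz by simp
qed

text \<open>Along a null geodesic \<open>\<psi>\<close> has vanishing second derivative.\<close>

lemma psi_along_null_geodesic:
  assumes c: "c \<in> A" and J: "open J" "\<gamma> ` J \<subseteq> fst c" and t: "t \<in> J"
    and ode: "\<And>s. s \<in> J \<Longrightarrow> ((snd c \<circ> \<gamma>) has_vector_derivative x' s) (at s)"
      "\<And>s. s \<in> J \<Longrightarrow> (x' has_vector_derivative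
              (\<chi> k. - (\<Sum>i\<in>UNIV. \<Sum>j\<in>UNIV.
                 christoffel (metric_matrix A g c) k i j (snd c (\<gamma> s)) * x' s $ i * x' s $ j))) (at s)"
    and null: "\<And>s. g (\<gamma> s) (velocity A \<gamma> s) (velocity A \<gamma> s) = 0"
  shows "((\<lambda>s. \<psi> (\<gamma> s)) has_real_derivative deriv (\<lambda>s. \<psi> (\<gamma> s)) t) (at t)"
    and "(deriv (\<lambda>s. \<psi> (\<gamma> s)) has_real_derivative 0) (at t)"
proof -
  let ?x = "snd c \<circ> \<gamma>" and ?h = "\<lambda>s. \<psi> (\<gamma> s)"
  let ?D = "\<lambda>s. \<Sum>i\<in>UNIV. x' s $ i * pderiv_at i (psi_chart c) (?x s)"
  have \<gamma>c: "\<gamma> s \<in> fst c" if "s \<in> J" for s using J that by blast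
  have x: "?x s \<in> snd c ` fst c" if "s \<in> J" for s using \<gamma>c[OF that] by simp
  note sm = psi_chart_smooth[OF c]
  have dh: "(?h has_real_derivative ?D s) (at s)" if s: "s \<in> J" for s
  proof -
    have "((\<lambda>s. psi_chart c (?x s)) has_real_derivative ?D s) (at s)"
      by (rule has_real_derivative_along[OF smooth_on_differentiable[OF sm x[OF s]] ode(1)[OF s]])
    then show ?thesis
      by (rule has_field_derivative_transform_within_open[OF _ J(1) s]) (use psi_chart_at[OF c \<gamma>c] in auto)
  qed
  have e: "deriv ?h s = ?D s" if "s \<in> J" for s using dh[OF that] by (rule DERIV_imp_deriv)
  show "(?h has_real_derivative deriv ?h t) (at t)" using dh[OF t] e[OF t] by simp
  have n: "g (\<gamma> t) (tvec c (\<gamma> t) (x' t)) (tvec c (\<gamma> t) (x' t)) = 0"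
    using null[of t] velocity_tvec[OF c J(1) t J(2) ode(1)[OF t]] by simp
  have "(?D has_real_derivative (\<Sum>j\<in>UNIV. \<Sum>k\<in>UNIV. x' t $ j * x' t $ k *
        (pderiv_at j (pderiv_at k (psi_chart c)) (?x t)
          - (\<Sum>m\<in>UNIV. christoffel (metric_matrix A g c) m j k (?x t) * pderiv_at m (psi_chart c) (?x t))))) (at t)"
    using ode[OF t] smooth_on_differentiable[OF smooth_on_pderiv[OF sm] x[OF t]]
    by (intro second_derivative_along_geodesic) (auto simp: comp_def)
  then have "(?D has_real_derivative 0) (at t)"
    using hessian_null[OF c \<gamma>c[OF t] n] by simp
  then show "(deriv ?h has_real_derivative 0) (at t)"
    by (rule has_field_derivative_transform_within_open[OF _ J(1) t]) (use e in auto)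
qed

text \<open>This is where completeness enters: the extended geodesic is null on the whole real line, and the affine
  function \<open>\<psi>\<close> along it has no zeros.\<close>

lemma null_derivative_zero:
  assumes complete: "light_line_complete A g"
    and c: "c \<in> A" "p \<in> fst c" and null: "g p (tvec c p v) (tvec c p v) = 0"
  shows "(\<Sum>i\<in>UNIV. v $ i * pderiv_at i (psi_chart c) (snd c p)) = 0"
proof (cases "v = 0")
  case False
  obtain \<epsilon> \<gamma>0 where \<epsilon>: "\<epsilon> > 0" and ll: "light_line_geodesic A g {-\<epsilon><..<\<epsilon>} \<gamma>0" and p: "\<gamma>0 0 = p"
    and im: "\<gamma>0 ` {-\<epsilon><..<\<epsilon>} \<subseteq> fst c" and d0: "((snd c \<circ> \<gamma>0) has_vector_derivative v) (at 0)"
    using null_geodesic_exists[OF c False null] by blast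
  let ?I = "{-\<epsilon><..<\<epsilon>}"
  have I0: "0 \<in> ?I" using \<epsilon> by simp
  obtain \<gamma> where geo: "geodesic A g UNIV \<gamma>" and eq: "\<And>t. t \<in> ?I \<Longrightarrow> \<gamma> t = \<gamma>0 t"
    using complete ll unfolding light_line_complete_def by blast
  have d: "((snd c \<circ> \<gamma>) has_vector_derivative v) (at 0)"
    by (rule has_vector_derivative_transform_within_open[OF d0 _ I0]) (use eq in auto)
  have \<gamma>p: "\<gamma> 0 = p" using eq[OF I0] p by simp
  have imc: "\<gamma> ` ?I \<subseteq> fst c" using im eq by auto
  have vel0: "velocity A \<gamma> 0 = tvec c p v"
    using velocity_tvec[OF c(1) open_greaterThanLessThan I0 imc d] \<gamma>p by simp
  have loc: "\<exists>c\<in>A. \<exists>J x'. open J \<and> t \<in> J \<and> \<gamma> ` J \<subseteq> fst c \<and>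
        (\<forall>s\<in>J. ((snd c \<circ> \<gamma>) has_vector_derivative x' s) (at s) \<and>
           (x' has_vector_derivative
              (\<chi> k. - (\<Sum>i\<in>UNIV. \<Sum>j\<in>UNIV.
                 christoffel (metric_matrix A g c) k i j (snd c (\<gamma> s)) * x' s $ i * x' s $ j)))
             (at s))" for t
    using geo[unfolded geodesic_def, THEN conjunct2, THEN conjunct2, THEN bspec, OF UNIV_I, of t]
    by (simp only: subset_UNIV simp_thms)
  let ?q = "\<lambda>s. g (\<gamma> s) (velocity A \<gamma> s) (velocity A \<gamma> s)"
  have "(?q has_real_derivative 0) (at t)" for t
  proof -
    obtain d J x' where "d \<in> A" "open J" "t \<in> J" "\<gamma> ` J \<subseteq> fst d"
      and "\<forall>s\<in>J. ((snd d \<circ> \<gamma>) has_vector_derivative x' s) (at s) \<and>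
           (x' has_vector_derivative
              (\<chi> k. - (\<Sum>i\<in>UNIV. \<Sum>j\<in>UNIV.
                 christoffel (metric_matrix A g d) k i j (snd d (\<gamma> s)) * x' s $ i * x' s $ j))) (at s)"
      using loc[of t] by (elim bexE exE conjE) (rule that)
    then show ?thesis by (intro geodesic_energy[of d J \<gamma> t x']) simp_all
  qed
  then have "?q t = ?q 0" for t using DERIV_isconst_all by blast
  then have nullt: "?q t = 0" for t using vel0 \<gamma>p null by simp
  let ?h = "\<lambda>s. \<psi> (\<gamma> s)"
  have dh: "(?h has_real_derivative deriv ?h t) (at t)" and ddh: "(deriv ?h has_real_derivative 0) (at t)" for t
  proof -
    obtain d J x' where c: "d \<in> A" and J: "open J" "\<gamma> ` J \<subseteq> fst d" "t \<in> J"
      and ode: "\<forall>s\<in>J. ((snd d \<circ> \<gamma>) has_vector_derivative x' s) (at s) \<and>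
           (x' has_vector_derivative
              (\<chi> k. - (\<Sum>i\<in>UNIV. \<Sum>j\<in>UNIV.
                 christoffel (metric_matrix A g d) k i j (snd d (\<gamma> s)) * x' s $ i * x' s $ j))) (at s)"
      using loc[of t] by (elim bexE exE conjE) (rule that)
    show "(?h has_real_derivative deriv ?h t) (at t)"
      by (rule psi_along_null_geodesic(1)[OF c J _ _ nullt, of x']) (use ode in simp_all)
    show "(deriv ?h has_real_derivative 0) (at t)"
      by (rule psi_along_null_geodesic(2)[OF c J _ _ nullt, of x']) (use ode in simp_all)
  qed
  define a where "a = deriv ?h 0"
  have "deriv ?h t = a" for t using ddh DERIV_isconst_all unfolding a_def by blast
  then have "((\<lambda>t. ?h t - a * t) has_real_derivative 0) (at t)" for t
    using dh[of t] by (auto intro!: derivative_eq_intros)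
  then have lin: "?h t - a * t = ?h 0 - a * 0" for t by (rule DERIV_isconst_all[rule_format])
  have aff: "?h t = ?h 0 + a * t" for t using lin[of t] by simp
  have nz: "?h t \<noteq> 0" for t
  proof -
    obtain d J where "d \<in> A" "\<gamma> t \<in> fst d" using loc[of t] by (elim bexE exE conjE) blast
    then show ?thesis using psi_nz chart_subset by blast
  qed
  have "a = 0"
  proof (rule ccontr)
    assume "a \<noteq> 0"
    then have "?h (- ?h 0 / a) = 0" using aff[of "- ?h 0 / a"] by simp
    then show False using nz by blast
  qed
  have "((\<lambda>s. psi_chart c ((snd c \<circ> \<gamma>) s)) has_real_derivative
      (\<Sum>i\<in>UNIV. v $ i * pderiv_at i (psi_chart c) ((snd c \<circ> \<gamma>) 0))) (at 0)"
    using c \<gamma>p by (intro has_real_derivative_along d smooth_on_differentiable[OF psi_chart_smooth]) auto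
  then have "(?h has_real_derivative (\<Sum>i\<in>UNIV. v $ i * pderiv_at i (psi_chart c) ((snd c \<circ> \<gamma>) 0))) (at 0)"
    by (rule has_field_derivative_transform_within_open[OF _ open_greaterThanLessThan I0])
      (use psi_chart_at[OF c(1) subsetD[OF imc imageI]] in auto)
  then have "a = (\<Sum>i\<in>UNIV. v $ i * pderiv_at i (psi_chart c) (snd c p))"
    unfolding a_def using DERIV_imp_deriv \<gamma>p by fastforce
  then show ?thesis using \<open>a = 0\<close> by simp
qed simp

lemma psi_constant:
  assumes conn: "connected_space X" and ind: "indefinite_metric X A g"
    and complete: "light_line_complete A g"
  shows "\<psi> constant_on topspace X"
proof -
  have dpsi: "(psi_chart c has_derivative (\<lambda>h. 0)) (at x)" if c: "c \<in> A" and x: "x \<in> snd c ` fst c" for c x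
  proof -
    obtain p where p: "p \<in> fst c" "x = snd c p" using x by blast
    obtain u w where u: "g p (tvec c p u) (tvec c p u) > 0" and w: "g p (tvec c p w) (tvec c p w) < 0"
      using not_definite_imp[OF c p(1)] indefinite_everywhere[OF conn ind chart_subset[OF c p(1)]] by blast
    have d: "psi_chart c differentiable (at x)" using psi_chart_smooth[OF c] smooth_on_differentiable x by blast
    have "frechet_derivative (psi_chart c) (at x) v = 0" for v
    proof (rule null_directions_span[OF metric_bilinear[OF c p(1)] metric_sym[OF c p(1)] linear_frechet_derivative[OF d] u w])
      fix v assume "g p (tvec c p v) (tvec c p v) = 0"
      then show "frechet_derivative (psi_chart c) (at x) v = 0"
        unfolding frechet_pderiv[OF d] using null_derivative_zero[OF complete c p(1)] p(2) by simp
    qed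
    then have "frechet_derivative (psi_chart c) (at x) = (\<lambda>h. 0)" by blast
    then show ?thesis using d unfolding frechet_derivative_works by simp
  qed
  have "\<psi> q = \<psi> p" if p: "p \<in> topspace X" and q: "q \<in> topspace X" for p q
  proof (rule connected_constant_property[where P = "\<lambda>q. \<psi> q = \<psi> p", OF conn p refl _ _ q])
    fix c assume c: "c \<in> A"
    let ?S = "snd c ` fst c"
    have S: "open ?S" by (rule chart_open[OF c])
    show "open {x \<in> ?S. \<psi> (chart_inv c x) = \<psi> p}"
    proof (rule open_subopen[THEN iffD2], intro ballI)
      fix x assume "x \<in> {x \<in> ?S. \<psi> (chart_inv c x) = \<psi> p}"
      then have x: "x \<in> ?S" "psi_chart c x = \<psi> p" by (auto simp: psi_chart_def)
      obtain r where r: "r > 0" "ball x r \<subseteq> ?S" using S x(1) open_contains_ball by blast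
      have "\<exists>k. \<forall>y\<in>ball x r. psi_chart c y = k"
        by (rule has_derivative_zero_constant[OF convex_ball
            has_derivative_at_withinI[OF dpsi[OF c subsetD[OF r(2)]]]])
      then have "psi_chart c y = \<psi> p" if "y \<in> ball x r" for y
        using that x(2) r(1) by (metis centre_in_ball)
      then show "\<exists>T. open T \<and> x \<in> T \<and> T \<subseteq> {x \<in> ?S. \<psi> (chart_inv c x) = \<psi> p}"
        using r by (intro exI[of _ "ball x r"]) (auto simp: psi_chart_def)
    qed
    have "open (?S \<inter> psi_chart c -` (- {\<psi> p}))"
      by (intro continuous_open_preimage S smooth_on_continuous_on psi_chart_smooth c) auto
    also have "?S \<inter> psi_chart c -` (- {\<psi> p}) = {x \<in> ?S. \<psi> (chart_inv c x) \<noteq> \<psi> p}"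
      by (auto simp: psi_chart_def)
    finally show "open {x \<in> ?S. \<psi> (chart_inv c x) \<noteq> \<psi> p}" .
  qed
  then show ?thesis unfolding constant_on_def by blast
qed

end

theorem theorem1:
  fixes X :: "'a topology"
    and A :: "('a, 'n::finite) chart set"
    and g :: "('a, 'n) metric"
    and \<psi> :: "'a \<Rightarrow> real"
  assumes "smooth_manifold X A"
    and "connected_space X"
    and "CARD('n) > 2"
    and "einstein_metric X A g"
    and "indefinite_metric X A g"
    and "light_line_complete A g"
    and "smooth_function A \<psi>"
    and "\<And>p. p \<in> topspace X \<Longrightarrow> \<psi> p \<noteq> 0"
    and "einstein_metric X A (\<lambda>p u v. \<psi> p powi (-2) * g p u v)"
  shows "\<psi> constant_on topspace X"
proof -
  interpret einstein_pair X A g \<psi>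
    using assms by unfold_locales (auto simp: einstein_metric_def)
  show ?thesis by (rule psi_constant[OF assms(2,5,6)])
qed

end
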